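(* Let $F=\{\mathbf{p}_0,\ldots,\mathbf{p}_n\}\subset\mathbb{R}^d$ be a finite set of points not contained in any $(d-1)$-dimensional affine subspace of $\mathbb{R}^d$. Then there exists $\delta_{uni}=\delta_{uni}(F)>0$ such that for every $\lambda\in(1-\delta_{uni},1)$, the homogeneous IFS $\Phi=\{S_i\}_{i=0}^n$ with $S_i(\mathbf{x})=\lambda\mathbf{x}+(1-\lambda)\mathbf{p}_i$ satisfies $X_{uni}=\mathrm{int}(X)$.
   Context: Write $\mathcal{D}=\{0,\ldots,n\}$ and $\mathcal{D}^*=\bigcup_{j\ge0}\mathcal{D}^j$ (finite words). $X\subset\mathbb{R}^d$ denotes the unique non-empty compact set with $X=\bigcup_{i\in\mathcal{D}}S_i(X)$, and $\mathrm{int}(X)$ is its interior in $\mathbb{R}^d$. The coding map $\pi:\mathcal{D}^{\mathbb{N}}\to X$ is $\pi(\mathbf{a})=\lim_{j\to\infty}(S_{a_1}\circ\cdots\circ S_{a_j})(\mathbf{0})$; $\mathbf{a}$ is a coding of $\mathbf{x}$ if $\pi(\mathbf{a})=\mathbf{x}$. A sequence $\mathbf{a}\in\mathcal{D}^{\mathbb{N}}$ is universal if every finite word in $\mathcal{D}^*$ appears in $\mathbf{a}$ as a block of consecutive digits. $X_{uni}$ is the set of $\mathbf{x}\in X$ having at least one universal coding. *)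

theory Defs
  imports "HOL-Analysis.Analysis"
begin

definition hmap :: "real \<Rightarrow> (nat \<Rightarrow> 'a::euclidean_space) \<Rightarrow> nat \<Rightarrow> 'a \<Rightarrow> 'a" where
  "hmap lam p i x = lam *\<^sub>R x + (1 - lam) *\<^sub>R p i"

fun word_map :: "real \<Rightarrow> (nat \<Rightarrow> 'a::euclidean_space) \<Rightarrow> (nat \<Rightarrow> nat) \<Rightarrow> nat \<Rightarrow> 'a \<Rightarrow> 'a" where
  "word_map lam p a 0 = id"
| "word_map lam p a (Suc j) = word_map lam p a j \<circ> hmap lam p (a j)"

definition coding :: "real \<Rightarrow> (nat \<Rightarrow> 'a::euclidean_space) \<Rightarrow> (nat \<Rightarrow> nat) \<Rightarrow> 'a" where
  "coding lam p a = lim (\<lambda>j. word_map lam p a j 0)"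

definition attractor :: "real \<Rightarrow> (nat \<Rightarrow> 'a::euclidean_space) \<Rightarrow> nat \<Rightarrow> 'a set" where
  "attractor lam p n = (THE X. X \<noteq> {} \<and> compact X \<and> X = (\<Union>i\<in>{..n}. hmap lam p i ` X))"

definition universal :: "nat \<Rightarrow> (nat \<Rightarrow> nat) \<Rightarrow> bool" where
  "universal n a \<longleftrightarrow> (\<forall>w::nat list. set w \<subseteq> {..n} \<longrightarrow>
      (\<exists>k. \<forall>i<length w. a (k + i) = w ! i))"

definition X_uni :: "real \<Rightarrow> (nat \<Rightarrow> 'a::euclidean_space) \<Rightarrow> nat \<Rightarrow> 'a set" where
  "X_uni lam p n = {x \<in> attractor lam p n. \<exists>a. (\<forall>k. a k \<le> n) \<and> universal n a \<and> coding lam p a = x}"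

end

theory Submission
  imports Defs
    "HOL-Computational_Algebra.Fundamental_Theorem_Algebra"
    "HOL-Computational_Algebra.Polynomial_Factorial"
    "HOL-Computational_Algebra.Polynomial_FPS"
    "HOL-Library.Sublist"
begin

text \<open>
  For \<open>lam\<close> close to 1 the attractor is the convex hull of the points \<open>p i\<close>. A point on the boundary of the
  hull lies on a supporting hyperplane, so some digit never occurs in any of its codings. For an interior
  point it suffices that its expanding orbits are dense: with \<open>q = 1 / lam\<close>, the points
  \<open>q^m x - (q - 1) \<Sum>j<m. q^j p (d j)\<close> come arbitrarily close to every target, so that any prescribed word
  can be appended after finitely many digits without leaving the interior.

  Density rests on an arithmetic fact about every base \<open>q\<close> in \<open>(1, 1.01)\<close>: the set of power sums
  \<open>\<Sum>k\<in>A. q^k\<close> over finite \<open>A\<close> is not uniformly discrete. Otherwise, by pigeonhole, \<open>q\<close> is an algebraic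
  integer, and replacing \<open>q\<close> by a conjugate gives a quasi-additive function of the power sum, which is within
  bounded distance of a linear one; this forces all other conjugates into the open unit disc, so \<open>q\<close> would be
  a Pisot number. If \<open>U\<close> is its minimal polynomial and \<open>U\<^sup>*\<close> the reciprocal polynomial, the power series
  \<open>U / U\<^sup>* = \<Sum> a\<^sub>n X^n\<close> has integer coefficients, and since \<open>(1 - q X) U / U\<^sup>*\<close> is \<open>X - q\<close> times a Blaschke
  product, \<open>\<Sum> (a\<^sub>n - q a\<^sub>n\<^sub>-\<^sub>1)\<^sup>2 \<le> 1 + q\<^sup>2\<close>. For \<open>q\<close> near 1 this is impossible.
\<close>

section \<open>Minimal polynomials over the integers\<close>

abbreviation ipoly :: "int poly \<Rightarrow> 'a::comm_ring_1 \<Rightarrow> 'a" where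
  "ipoly p x \<equiv> poly (map_poly of_int p) x"

lemma ipoly_add: "ipoly (p + r) x = ipoly p x + ipoly r x"
  by (induction p r rule: poly_induct2) (simp_all add: map_poly_pCons algebra_simps)

lemma ipoly_diff: "ipoly (p - r) x = ipoly p x - ipoly r x"
  using ipoly_add[of "p - r" r x] by simp

lemma ipoly_smult: "ipoly (smult c p) x = of_int c * ipoly p x"
  by (induction p) (simp_all add: map_poly_pCons algebra_simps)

lemma ipoly_mult: "ipoly (p * r) x = ipoly p x * ipoly r x"
  by (induction p) (simp_all add: map_poly_pCons ipoly_add ipoly_smult algebra_simps)

lemma ipoly_of_int: "ipoly p (of_int k) = of_int (poly p k)"
  by (induction p) (simp_all add: map_poly_pCons)

lemma ipoly_of_real:
  "ipoly p (of_real x :: 'a::{comm_ring_1,real_algebra_1}) = of_real (ipoly p x)"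
  by (induction p) (simp_all add: map_poly_pCons)

lemma ipoly_eq_0_if_dvd: "p dvd r \<Longrightarrow> ipoly p x = 0 \<Longrightarrow> ipoly r x = 0"
  by (auto elim!: dvdE simp: ipoly_mult)

lemma map_poly_of_int_reflect:
  "map_poly of_int (reflect_poly p)
    = (reflect_poly (map_poly of_int p) :: 'a::{comm_ring_1,ring_char_0} poly)"
  by (intro poly_eqI) (simp add: coeff_map_poly coeff_reflect_poly degree_map_poly)

lemma map_poly_of_int_pderiv:
  "map_poly of_int (pderiv p) = pderiv (map_poly of_int p :: 'a::idom poly)"
  by (intro poly_eqI) (simp add: coeff_map_poly coeff_pderiv)

lemma primitive_dvd_if_dvd_smult:
  fixes U S :: "'a::{factorial_ring_gcd,normalization_semidom_multiplicative} poly"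
  assumes "content U = 1" "a \<noteq> 0" "U dvd smult a S"
  shows "U dvd S"
proof -
  obtain T where T: "smult a S = U * T" using assms(3) by (elim dvdE)
  have "content T = normalize a * content S"
    using arg_cong[OF T, of content] assms(1) by (simp add: content_mult)
  then have "[:a:] dvd T" by (simp add: const_poly_dvd_iff_dvd_content)
  then obtain T' where "T = smult a T'" by (auto elim: dvdE)
  then have "smult a S = smult a (U * T')" using T by simp
  then show ?thesis using assms(2) by (metis smult_cancel dvd_triv_left)
qed

lemma int_poly_kernel_principal:
  fixes x :: "'a::{idom,ring_char_0}"
  shows "\<exists>U. \<forall>S. ipoly S x = 0 \<longleftrightarrow> U dvd S"
proof (cases "\<forall>S. ipoly S x = 0 \<longrightarrow> S = 0")
  case True
  then show ?thesis by (intro exI[of _ 0]) auto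
next
  case False
  then obtain R where "R \<noteq> 0 \<and> ipoly R x = 0" by blast
  then obtain W where W: "W \<noteq> 0" "ipoly W x = 0"
    and min: "\<And>S. S \<noteq> 0 \<Longrightarrow> ipoly S x = 0 \<Longrightarrow> degree W \<le> degree S"
    using ex_has_least_nat[of "\<lambda>S. S \<noteq> 0 \<and> ipoly S x = 0" R degree] by blast
  define U where "U = primitive_part W"
  have U: "U \<noteq> 0" "content U = 1" "degree U = degree W" using W(1) by (simp_all add: U_def)
  have "ipoly W x = of_int (content W) * ipoly U x"
    using ipoly_smult[of "content W" U x] by (simp add: U_def)
  then have Ux: "ipoly U x = 0" using W by simp
  have "U dvd S" if S: "ipoly S x = 0" for S
  proof -
    obtain a T where pseudo: "a \<noteq> 0" "smult a S = U * T + pseudo_mod S U"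
      using pseudo_mod(1)[OF U(1)] by blast
    have "ipoly (pseudo_mod S U) x = 0"
      using arg_cong[OF pseudo(2), of "\<lambda>p. ipoly p x"] S Ux by (simp add: ipoly_add ipoly_mult ipoly_smult)
    then have "pseudo_mod S U = 0"
      using min[of "pseudo_mod S U"] pseudo_mod(2)[OF U(1), of S] U(3) by linarith
    then show ?thesis using primitive_dvd_if_dvd_smult[OF U(2) pseudo(1)] pseudo(2) by simp
  qed
  then show ?thesis using ipoly_eq_0_if_dvd[OF _ Ux] by blast
qed

lemma algebraic_int_minimal_polynomial:
  fixes x :: "'a::field_char_0"
  assumes "algebraic_int x"
  obtains U where "lead_coeff U = 1" "\<And>S. ipoly S x = 0 \<longleftrightarrow> U dvd S"
proof -
  obtain U where U: "\<And>S. ipoly S x = 0 \<longleftrightarrow> U dvd S" using int_poly_kernel_principal[of x] by blast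
  obtain R where R: "ipoly R x = 0" "lead_coeff R = 1"
    using assms by (auto simp: algebraic_int_altdef_ipoly)
  have "U dvd R" using R(1) by (simp only: U)
  then obtain T where "R = U * T" by (elim dvdE)
  then have "lead_coeff U * lead_coeff T = 1" using R(2) by (simp add: lead_coeff_mult)
  then consider (monic) "lead_coeff U = 1" | (minus_monic) "lead_coeff (- U) = 1"
    by (auto simp: zmult_eq_1_iff)
  then show ?thesis
  proof cases
    case monic
    then show ?thesis using U by (rule that)
  next
    case minus_monic
    then show ?thesis using U by (intro that[of "- U"]) (simp_all add: minus_dvd_iff)
  qed
qed

lemma minimal_polynomial_coeff_0_nonzero:
  fixes x :: "'a::{idom,ring_char_0}"
  assumes U: "\<And>S. ipoly S x = 0 \<longleftrightarrow> U dvd S" and "U \<noteq> 0" "x \<noteq> 0"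
  shows "coeff U 0 \<noteq> 0"
proof
  assume "coeff U 0 = 0"
  then obtain W where W: "U = pCons 0 W" by (metis pCons_cases coeff_pCons_0)
  have "ipoly U x = 0" by (simp add: U)
  then have "ipoly W x = 0" using \<open>x \<noteq> 0\<close> by (simp add: W map_poly_pCons)
  then have "U dvd W" by (simp only: U)
  moreover have "W \<noteq> 0" using \<open>U \<noteq> 0\<close> W by auto
  ultimately have "degree U \<le> degree W" by (rule dvd_imp_degree_le)
  then show False using \<open>W \<noteq> 0\<close> by (simp add: W)
qed

lemma minimal_polynomial_simple_root:
  fixes x :: "'a::{idom,ring_char_0}"
  assumes U: "\<And>S. ipoly S x = 0 \<longleftrightarrow> U dvd S" and "U \<noteq> 0"
  shows "ipoly (pderiv U) x \<noteq> 0"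
proof
  assume "ipoly (pderiv U) x = 0"
  then have "U dvd pderiv U" by (simp add: U)
  then have "degree U = 0" by (simp add: not_dvd_pderiv)
  then obtain c where "U = [:c:]" by (auto elim: degree_eq_zeroE)
  moreover have "ipoly U x = 0" by (simp add: U)
  ultimately show False using \<open>U \<noteq> 0\<close> by (simp add: map_poly_pCons)
qed

section \<open>Blaschke products\<close>

definition fps_energy :: "complex fps \<Rightarrow> nat \<Rightarrow> real" where
  "fps_energy f N = (\<Sum>n\<le>N. (cmod (fps_nth f n))\<^sup>2)"

lemma fps_energy_blaschke_factor_le:
  assumes "cmod \<alpha> \<le> 1"
  shows "fps_energy ((fps_X - fps_const (cnj \<alpha>)) * h) N \<le> fps_energy ((1 - fps_const \<alpha> * fps_X) * h) N"
proof -
  have nth: "fps_nth ((fps_X - fps_const (cnj \<alpha>)) * h) n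
        = (if n = 0 then 0 else fps_nth h (n - 1)) - cnj \<alpha> * fps_nth h n"
      "fps_nth ((1 - fps_const \<alpha> * fps_X) * h) n
        = fps_nth h n - \<alpha> * (if n = 0 then 0 else fps_nth h (n - 1))" for n
    by (simp_all add: algebra_simps)
  have identity: "(cmod (b - \<alpha> * a))\<^sup>2 - (cmod (a - cnj \<alpha> * b))\<^sup>2
      = (1 - (cmod \<alpha>)\<^sup>2) * ((cmod b)\<^sup>2 - (cmod a)\<^sup>2)" for a b
    unfolding cmod_power2 by (simp add: algebra_simps power2_eq_square)
  have "fps_energy ((1 - fps_const \<alpha> * fps_X) * h) N - fps_energy ((fps_X - fps_const (cnj \<alpha>)) * h) N
      = (1 - (cmod \<alpha>)\<^sup>2) * (cmod (fps_nth h N))\<^sup>2"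
  proof (induction N)
    case 0
    show ?case using identity[of "fps_nth h 0" 0] unfolding fps_energy_def nth by simp
  next
    case (Suc N)
    then show ?case using identity[of "fps_nth h (Suc N)" "fps_nth h N"]
      unfolding fps_energy_def nth by (simp add: algebra_simps)
  qed
  moreover have "0 \<le> \<dots>"
    using assms by (intro mult_nonneg_nonneg) (auto simp: power_le_one)
  ultimately show ?thesis by linarith
qed

lemma fps_of_poly_linear_root:
  fixes c :: "'a::field"
  shows "fps_of_poly [:- c, 1:] = fps_X - fps_const c"
    and "fps_of_poly (reflect_poly [:- c, 1:]) = 1 - fps_const c * fps_X"
proof -
  show "fps_of_poly [:- c, 1:] = fps_X - fps_const c"
    by (simp add: fps_of_poly_linear flip: fps_const_neg)
  have "reflect_poly [:- c, 1:] = [:1, - c:]"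
    by (cases "c = 0") (simp_all add: reflect_poly_def)
  then show "fps_of_poly (reflect_poly [:- c, 1:]) = 1 - fps_const c * fps_X"
    by (simp add: fps_of_poly_linear' flip: fps_const_neg)
qed

lemma map_poly_cnj_mult: "map_poly cnj (p * r) = map_poly cnj p * map_poly cnj r"
  by (simp add: poly_eq_poly_eq_iff[symmetric] fun_eq_iff)

lemma complex_poly_split_root:
  fixes V :: "complex poly"
  assumes "degree V = Suc d"
  obtains \<alpha> W where "V = [:- \<alpha>, 1:] * W" "degree W = d" "poly V \<alpha> = 0"
proof -
  obtain \<alpha> where \<alpha>: "poly V \<alpha> = 0" using assms alg_closed_imp_poly_has_root[of V] by auto
  then obtain W where W: "V = [:- \<alpha>, 1:] * W" unfolding poly_eq_0_iff_dvd by (elim dvdE)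
  moreover have "W \<noteq> 0" using assms W by auto
  then have "degree V = Suc (degree W)" unfolding W by (subst degree_mult_eq) auto
  ultimately show ?thesis using assms \<alpha> that by simp
qed

lemma fps_energy_blaschke_le:
  assumes "\<And>\<alpha>. poly V \<alpha> = 0 \<Longrightarrow> cmod \<alpha> \<le> 1"
  shows "fps_energy (fps_of_poly (map_poly cnj V) * h) N \<le> fps_energy (fps_of_poly (reflect_poly V) * h) N"
  using assms
proof (induction "degree V" arbitrary: V h)
  case 0
  then obtain c where "V = [:c:]" by (metis degree_eq_zeroE)
  then show ?case by (simp add: fps_energy_def fps_of_poly_const map_poly_pCons norm_mult)
next
  case (Suc d)
  obtain \<alpha> W where V: "V = [:- \<alpha>, 1:] * W" and W: "degree W = d" and \<alpha>: "poly V \<alpha> = 0"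
    using complex_poly_split_root[of V d] Suc.hyps(2) by metis
  let ?lin = "fps_X - fps_const (cnj \<alpha>)"
  have "map_poly cnj V = [:- cnj \<alpha>, 1:] * map_poly cnj W"
    unfolding V map_poly_cnj_mult by (simp add: map_poly_pCons)
  then have "fps_energy (fps_of_poly (map_poly cnj V) * h) N
      = fps_energy (fps_of_poly (map_poly cnj W) * (?lin * h)) N"
    by (simp only: fps_of_poly_mult fps_of_poly_linear_root(1) mult_ac)
  also have "\<dots> \<le> fps_energy (fps_of_poly (reflect_poly W) * (?lin * h)) N"
    using Suc.prems by (intro Suc.hyps(1)) (simp_all add: W V)
  also have "\<dots> = fps_energy (?lin * (fps_of_poly (reflect_poly W) * h)) N"
    by (simp only: mult_ac)
  also have "\<dots> \<le> fps_energy ((1 - fps_const \<alpha> * fps_X) * (fps_of_poly (reflect_poly W) * h)) N"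
    using Suc.prems \<alpha> by (intro fps_energy_blaschke_factor_le)
  also have "\<dots> = fps_energy (fps_of_poly (reflect_poly V) * h) N"
    by (simp only: V reflect_poly_mult fps_of_poly_mult fps_of_poly_linear_root(2) mult_ac)
  finally show ?case .
qed

section \<open>No Pisot numbers near 1\<close>

lemma int_jump_le_cost:
  fixes q :: real and x y :: int
  assumes q: "1 < q" "q < 1 + 1/100" and y: "\<bar>y\<bar> \<le> 4"
  shows "4 * real_of_int \<bar>x - y\<bar> \<le> 5 * (x - q * y)\<^sup>2"
proof (cases "x = y")
  case False
  define t where "t = \<bar>real_of_int (x - y)\<bar>"
  have t: "1 \<le> t" using False unfolding t_def by linarith
  have "\<bar>real_of_int y\<bar> \<le> 4" using y by linarith
  then have "\<bar>(q - 1) * y\<bar> \<le> 1/25"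
    using q mult_mono[of "q - 1" "1/100" "\<bar>real_of_int y\<bar>" 4] by (simp add: abs_mult)
  moreover have "x - q * y = real_of_int (x - y) - (q - 1) * y" by (simp add: algebra_simps)
  ultimately have "t - 1/25 \<le> \<bar>x - q * y\<bar>" unfolding t_def by linarith
  then have "(t - 1/25)\<^sup>2 \<le> (x - q * y)\<^sup>2"
    using t power_mono[of "t - 1/25" "\<bar>x - q * y\<bar>" 2] by simp
  moreover have "t * 1 \<le> t * t" using t by (intro mult_left_mono) auto
  then have "4 * t \<le> 5 * (t - 1/25)\<^sup>2"
    using t unfolding power2_eq_square left_diff_distrib right_diff_distrib by linarith
  ultimately show ?thesis by (simp add: t_def)
qed simp

text \<open>The bounds on the values and on the variation support each other: as long as \<open>\<bar>A n\<bar> \<le> 4\<close>, the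
  variation so far is at most \<open>15/4\<close> by the preceding lemma, which keeps the next value below 4.\<close>

lemma int_variation_bounded:
  fixes A :: "nat \<Rightarrow> int" and q :: real
  assumes q: "1 < q" "q < 1 + 1/100" and A0: "A 0 = 0"
    and cost: "\<And>N. (\<Sum>n<N. (A (Suc n) - q * A n)\<^sup>2) \<le> 3"
  shows "(\<Sum>n<N. \<bar>A (Suc n) - A n\<bar>) \<le> 4"
proof (induction N)
  case (Suc N)
  have value_le: "\<bar>A n\<bar> \<le> (\<Sum>k<n. \<bar>A (Suc k) - A k\<bar>)" for n
  proof (induction n)
    case (Suc n)
    have "\<bar>A (Suc n)\<bar> \<le> \<bar>A (Suc n) - A n\<bar> + \<bar>A n\<bar>" by simp
    with Suc show ?case by simp
  qed (simp add: A0)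
  have "\<bar>A n\<bar> \<le> 4" if "n \<le> N" for n
    using value_le[of n] Suc.IH sum_mono2[of "{..<N}" "{..<n}" "\<lambda>k. \<bar>A (Suc k) - A k\<bar>"] that
    by fastforce
  then have "(\<Sum>n<Suc N. 4 * real_of_int \<bar>A (Suc n) - A n\<bar>) \<le> (\<Sum>n<Suc N. 5 * (A (Suc n) - q * A n)\<^sup>2)"
    using q by (intro sum_mono int_jump_le_cost) auto
  also have "\<dots> \<le> 15" using cost[of "Suc N"] unfolding sum_distrib_left[symmetric] by simp
  finally have "real_of_int (4 * (\<Sum>n<Suc N. \<bar>A (Suc n) - A n\<bar>)) \<le> real_of_int 15"
    unfolding sum_distrib_left of_int_sum by simp
  then show ?case unfolding of_int_le_iff by linarith
qed simp

lemma int_bounded_variation_eventually_const: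
  fixes A :: "nat \<Rightarrow> int"
  assumes "\<And>N. (\<Sum>n<N. \<bar>A (Suc n) - A n\<bar>) \<le> C"
  obtains M where "\<And>n. M \<le> n \<Longrightarrow> A n = A M"
proof -
  define D where "D N = (\<Sum>n<N. \<bar>A (Suc n) - A n\<bar>)" for N
  have "finite (range D)"
    by (rule finite_subset[of _ "{0..C}"]) (use assms in \<open>auto simp: D_def sum_nonneg\<close>)
  moreover from this have "Max (range D) \<in> range D" by (intro Max_in) auto
  ultimately obtain M where M: "\<And>n. D n \<le> D M" by (metis Max_ge rangeE rangeI)
  have "A n = A M" if "M \<le> n" for n
    using that
  proof (induction rule: dec_induct)
    case (step n)
    have "D M \<le> D n" unfolding D_def using step.hyps by (intro sum_mono2) auto
    then have "\<bar>A (Suc n) - A n\<bar> \<le> 0" using M[of "Suc n"] by (simp add: D_def)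
    then show ?case using step.IH by simp
  qed simp
  then show ?thesis by (rule that)
qed

lemma int_sequence_eventually_zero:
  fixes A :: "nat \<Rightarrow> int" and q :: real
  assumes q: "1 < q" "q < 1 + 1/100" and A0: "A 0 = 0"
    and cost: "\<And>N. (\<Sum>n<N. (A (Suc n) - q * A n)\<^sup>2) \<le> 3"
  shows "\<exists>N. \<forall>n\<ge>N. A n = 0"
proof -
  obtain M where M: "\<And>n. M \<le> n \<Longrightarrow> A n = A M"
    using int_bounded_variation_eventually_const int_variation_bounded[OF q A0 cost] by metis
  define c where "c = ((1 - q) * A M)\<^sup>2"
  have "real k * c \<le> 3" for k
  proof -
    have "(A (Suc n) - q * A n)\<^sup>2 = c" if "n \<in> {M..<M+k}" for n
      using M[of n] M[of "Suc n"] that by (simp add: c_def algebra_simps)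
    then have "real k * c = (\<Sum>n\<in>{M..<M+k}. (A (Suc n) - q * A n)\<^sup>2)" by simp
    also have "\<dots> \<le> (\<Sum>n<M+k. (A (Suc n) - q * A n)\<^sup>2)" by (intro sum_mono2) auto
    also have "\<dots> \<le> 3" by (rule cost)
    finally show ?thesis .
  qed
  then have "\<not> 0 < c" using ex_less_of_nat_mult[of c 3] by (meson not_le)
  then have "A M = 0" using q by (simp add: c_def)
  then show ?thesis using M by metis
qed

lemma monic_poly_norm_le_1:
  fixes V :: "complex poly"
  assumes "lead_coeff V = 1" "\<And>\<alpha>. poly V \<alpha> = 0 \<Longrightarrow> cmod (z - \<alpha>) \<le> 1"
  shows "cmod (poly V z) \<le> 1"
  using assms
proof (induction "degree V" arbitrary: V)
  case 0
  then obtain c where "V = [:c:]" by (metis degree_eq_zeroE)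
  then show ?case using 0 by simp
next
  case (Suc d)
  obtain \<alpha> W where V: "V = [:- \<alpha>, 1:] * W" and W: "degree W = d" and \<alpha>: "poly V \<alpha> = 0"
    using complex_poly_split_root[of V d] Suc.hyps(2) by metis
  have "lead_coeff W = 1" using Suc.prems(1) unfolding V lead_coeff_mult by simp
  then have "cmod (poly W z) \<le> 1" using Suc.hyps(1)[of W] W Suc.prems(2) by (simp add: V)
  then show ?case using Suc.prems(2)[OF \<alpha>] by (simp add: V norm_mult mult_le_one flip: left_diff_distrib)
qed

definition complex_fps :: "int fps \<Rightarrow> complex fps" where
  "complex_fps f = Abs_fps (\<lambda>n. of_int (fps_nth f n))"

lemma complex_fps_nth [simp]: "fps_nth (complex_fps f) n = of_int (fps_nth f n)"
  by (simp add: complex_fps_def)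

lemma complex_fps_mult: "complex_fps (f * g) = complex_fps f * complex_fps g"
  by (intro fps_ext) (simp add: fps_mult_nth)

lemma complex_fps_of_poly: "complex_fps (fps_of_poly p) = fps_of_poly (map_poly of_int p)"
  by (intro fps_ext) (simp add: coeff_map_poly)

definition pisot :: "real \<Rightarrow> bool" where
  "pisot q \<longleftrightarrow> 1 < q \<and> algebraic_int q \<and>
     (\<forall>\<alpha>::complex. (\<forall>S. ipoly S q = 0 \<longrightarrow> ipoly S \<alpha> = 0) \<longrightarrow> \<alpha> \<noteq> of_real q \<longrightarrow> cmod \<alpha> < 1)"

locale pisot_polynomial =
  fixes U :: "int poly" and q :: real
  assumes q_gt_1: "1 < q"
    and monic: "lead_coeff U = 1"
    and coeff_0: "coeff U 0 \<noteq> 0"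
    and root: "ipoly U q = 0"
    and simple_root: "ipoly (pderiv U) q \<noteq> 0"
    and other_roots: "\<And>\<alpha>::complex. ipoly U \<alpha> = 0 \<Longrightarrow> \<alpha> \<noteq> of_real q \<Longrightarrow> cmod \<alpha> < 1"
begin

definition cofactor :: "complex poly" where
  "cofactor = map_poly of_int U div [:- of_real q, 1:]"

lemma factorization: "map_poly of_int U = [:- of_real q, 1:] * cofactor"
proof -
  have "ipoly U (complex_of_real q) = 0" using root by (simp add: ipoly_of_real)
  then show ?thesis by (simp only: cofactor_def dvd_mult_div_cancel poly_eq_0_iff_dvd)
qed

lemma cofactor_roots:
  assumes "poly cofactor \<alpha> = 0"
  shows "ipoly U \<alpha> = 0" "cmod \<alpha> < 1"
proof -
  show "ipoly U \<alpha> = 0" unfolding factorization using assms by simp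
  have "ipoly (pderiv U) (complex_of_real q) = poly cofactor (of_real q)"
    unfolding map_poly_of_int_pderiv factorization pderiv_mult by (simp add: pderiv_pCons)
  then have "poly cofactor (of_real q) \<noteq> 0" using simple_root by (metis ipoly_of_real of_real_eq_0_iff)
  then show "cmod \<alpha> < 1" using other_roots \<open>ipoly U \<alpha> = 0\<close> assms by metis
qed

lemma lead_coeff_cofactor: "lead_coeff cofactor = 1"
proof -
  have "lead_coeff (map_poly of_int U) = (1::complex)"
    using monic by (simp add: coeff_map_poly degree_map_poly)
  then show ?thesis unfolding factorization lead_coeff_mult by simp
qed

lemma map_poly_cnj_cofactor: "map_poly cnj cofactor = cofactor"
proof -
  have "map_poly cnj (map_poly of_int U) = map_poly of_int U"
    by (intro poly_eqI) (simp add: coeff_map_poly)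
  then have "[:- of_real q, 1:] * map_poly cnj cofactor = [:- of_real q, 1:] * cofactor"
    unfolding factorization map_poly_cnj_mult by (simp add: map_poly_pCons)
  then show ?thesis by (simp only: mult_cancel_left) simp
qed

definition quotient_series :: "int fps" where
  "quotient_series = fps_of_poly U * fps_right_inverse (fps_of_poly (reflect_poly U)) 1"

lemma reflect_mult_quotient_series: "fps_of_poly (reflect_poly U) * quotient_series = fps_of_poly U"
  using fps_right_inverse[of "fps_of_poly (reflect_poly U)" 1] monic
  by (simp add: quotient_series_def mult.left_commute)

lemma quotient_series_energy_le:
  "fps_energy ((1 - fps_const (of_real q) * fps_X) * complex_fps quotient_series) N \<le> 1 + q\<^sup>2"
proof -
  let ?V = "fps_of_poly cofactor" and ?V' = "fps_of_poly (reflect_poly cofactor)"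
  let ?lin = "fps_X - fps_const (of_real q)" and ?lin' = "1 - fps_const (of_real q) * fps_X"
  define h where "h = ?lin * inverse ?V'"
  have "fps_nth ?V' 0 \<noteq> 0" using lead_coeff_cofactor by simp
  then have h: "?V' * h = ?lin" and "?V' \<noteq> 0"
    by (auto simp: h_def mult.left_commute[of ?V'] inverse_mult_eq_1')
  have "(?lin' * ?V') * complex_fps quotient_series = ?lin * ?V"
    using arg_cong[OF reflect_mult_quotient_series, of complex_fps]
    by (simp only: complex_fps_mult complex_fps_of_poly map_poly_of_int_reflect
        factorization reflect_poly_mult fps_of_poly_mult fps_of_poly_linear_root)
  then have "?V' * (?lin' * complex_fps quotient_series) = ?V' * (?V * h)"
    by (simp add: mult_ac flip: h)
  then have "fps_energy (?lin' * complex_fps quotient_series) N = fps_energy (?V * h) N"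
    using \<open>?V' \<noteq> 0\<close> by simp
  also have "\<dots> \<le> fps_energy (?V' * h) N"
    using fps_energy_blaschke_le[of cofactor h N] cofactor_roots(2)
    by (simp add: map_poly_cnj_cofactor less_imp_le)
  also have "\<dots> = (\<Sum>n\<le>N. (if n = 1 then 1 else 0) + (if n = 0 then q\<^sup>2 else 0))"
    unfolding h fps_energy_def by (intro sum.cong) auto
  also have "\<dots> \<le> 1 + q\<^sup>2" by (simp add: sum.distrib)
  finally show ?thesis .
qed

lemma quotient_series_eventually_zero:
  assumes "q < 1 + 1/100"
  shows "\<exists>N. \<forall>n\<ge>N. fps_nth quotient_series n = 0"
proof -
  define A where "A n = fps_nth (fps_X * quotient_series) n" for n
  have nth: "fps_nth ((1 - fps_const (of_real q) * fps_X) * complex_fps quotient_series) n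
      = of_real (A (Suc n) - q * A n)" for n
    by (simp add: A_def left_diff_distrib mult.assoc)
  have "(\<Sum>n<N. (A (Suc n) - q * A n)\<^sup>2) \<le> 3" for N
  proof -
    have "(\<Sum>n<N. (A (Suc n) - q * A n)\<^sup>2) \<le> (\<Sum>n\<le>N. (A (Suc n) - q * A n)\<^sup>2)"
      by (intro sum_mono2) auto
    also have "\<dots> \<le> 1 + q\<^sup>2"
      using quotient_series_energy_le[of N] unfolding fps_energy_def nth norm_of_real by simp
    also have "\<dots> \<le> 3"
      using assms q_gt_1 power_mono[of q "1 + 1/100" 2] by (simp add: power2_eq_square)
    finally show ?thesis .
  qed
  moreover have "A 0 = 0" by (simp add: A_def)
  ultimately obtain N where "\<forall>n\<ge>N. A n = 0"
    using int_sequence_eventually_zero[OF q_gt_1 assms] by blast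
  then have "fps_nth quotient_series n = 0" if "N \<le> n" for n
    using that by (auto simp: A_def dest!: spec[of _ "Suc n"])
  then show ?thesis by blast
qed

text \<open>If \<open>U = U\<^sup>* p\<close>, the reciprocal of a small root is again a root of \<open>U\<close>, hence equal to \<open>q\<close>.\<close>

lemma not_reflect_dvd:
  assumes "q < 2"
  shows "\<not> reflect_poly U dvd U"
proof
  assume dvd: "reflect_poly U dvd U"
  have root_eq: "\<alpha> = of_real (1 / q)" if \<alpha>: "poly cofactor \<alpha> = 0" for \<alpha>
  proof -
    have "\<alpha> \<noteq> 0" using cofactor_roots(1)[OF \<alpha>] coeff_0 by (auto simp: poly_0_coeff_0 coeff_map_poly)
    have "ipoly (reflect_poly U) (inverse \<alpha>) = 0"
      using \<open>\<alpha> \<noteq> 0\<close> cofactor_roots(1)[OF \<alpha>] by (simp add: map_poly_of_int_reflect poly_reflect_poly_nz)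
    with dvd have "ipoly U (inverse \<alpha>) = 0" by (rule ipoly_eq_0_if_dvd)
    moreover have "\<not> cmod (inverse \<alpha>) < 1"
      using cofactor_roots(2)[OF \<alpha>] \<open>\<alpha> \<noteq> 0\<close> one_less_inverse[of "cmod \<alpha>"] by (simp add: norm_inverse)
    ultimately have "inverse \<alpha> = of_real q" using other_roots by blast
    then show ?thesis by (metis inverse_eq_divide inverse_inverse_eq of_real_inverse)
  qed
  have "cmod (1 - \<alpha>) \<le> 1" if "poly cofactor \<alpha> = 0" for \<alpha>
    using q_gt_1 norm_of_real[of "1 - 1 / q", where 'a=complex] by (simp add: root_eq[OF that])
  then have "cmod (poly cofactor 1) \<le> 1" by (intro monic_poly_norm_le_1 lead_coeff_cofactor)
  then have "(q - 1) * cmod (poly cofactor 1) \<le> (q - 1) * 1"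
    using q_gt_1 by (intro mult_left_mono) auto
  moreover have "ipoly U (1::complex) = of_real (1 - q) * poly cofactor 1"
    unfolding factorization by (simp add: algebra_simps)
  then have "cmod (ipoly U 1) = (q - 1) * cmod (poly cofactor 1)"
    using q_gt_1 by (simp only: norm_mult norm_of_real) simp
  moreover have U1: "ipoly U (1::complex) = of_int (poly U 1)" using ipoly_of_int[of U 1] by simp
  ultimately have "real_of_int \<bar>poly U 1\<bar> < 1" using assms by simp
  then have "ipoly U (1::complex) = 0" by (simp add: U1)
  then show False using other_roots[of 1] q_gt_1 by simp
qed

lemma q_ge: "1 + 1/100 \<le> q"
proof (rule ccontr)
  assume "\<not> 1 + 1/100 \<le> q"
  then obtain N where "\<And>n. N \<le> n \<Longrightarrow> fps_nth quotient_series n = 0"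
    using quotient_series_eventually_zero by auto
  then have "quotient_series = fps_of_poly (truncate_fps N quotient_series)"
    by (intro fps_ext) (simp add: coeff_truncate_fps)
  then have "fps_of_poly (reflect_poly U * truncate_fps N quotient_series) = fps_of_poly U"
    using reflect_mult_quotient_series by (simp add: fps_of_poly_mult)
  then have "reflect_poly U dvd U" by (metis dvd_triv_left fps_of_poly_eq_iff)
  then show False using not_reflect_dvd \<open>\<not> 1 + 1/100 \<le> q\<close> by simp
qed

end

theorem pisot_ge:
  assumes "pisot q"
  shows "1 + 1/100 \<le> q"
proof -
  have q: "1 < q" "algebraic_int q" using assms by (auto simp: pisot_def)
  obtain U where U: "lead_coeff U = 1" "\<And>S. ipoly S q = 0 \<longleftrightarrow> U dvd S"
    using algebraic_int_minimal_polynomial[OF q(2)] by blast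
  then have "U \<noteq> 0" by auto
  have "ipoly S \<alpha> = 0" if "ipoly U \<alpha> = 0" "ipoly S q = 0" for S and \<alpha> :: complex
    using that ipoly_eq_0_if_dvd by (simp only: U(2))
  then have "cmod \<alpha> < 1" if "ipoly U \<alpha> = 0" "\<alpha> \<noteq> of_real q" for \<alpha>
    using assms that by (auto simp: pisot_def)
  then interpret pisot_polynomial U q
    using q(1) U \<open>U \<noteq> 0\<close> minimal_polynomial_coeff_0_nonzero[OF U(2)] minimal_polynomial_simple_root[OF U(2)]
    by unfold_locales auto
  show ?thesis by (rule q_ge)
qed

section \<open>Uniformly discrete spectra\<close>

definition power_sum :: "'a::comm_ring_1 \<Rightarrow> nat set \<Rightarrow> 'a" where
  "power_sum x A = (\<Sum>k\<in>A. x ^ k)"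

definition spectrum :: "real \<Rightarrow> real set" where
  "spectrum q = power_sum q ` Fpow UNIV"

lemma power_sum_Un_disjoint:
  "finite A \<Longrightarrow> finite B \<Longrightarrow> A \<inter> B = {} \<Longrightarrow> power_sum x (A \<union> B) = power_sum x A + power_sum x B"
  unfolding power_sum_def by (rule sum.union_disjoint)

lemma power_sum_affine_image:
  "0 < m \<Longrightarrow> power_sum x ((\<lambda>k. m * k + r) ` A) = (\<Sum>k\<in>A. x ^ (m * k + r))"
  unfolding power_sum_def by (subst sum.reindex) (auto simp: inj_on_def)

definition indicator_poly :: "nat set \<Rightarrow> int poly" where
  "indicator_poly A = (\<Sum>k\<in>A. monom 1 k)"

lemma coeff_indicator_poly: "finite A \<Longrightarrow> coeff (indicator_poly A) i = (if i \<in> A then 1 else 0)"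
  by (simp add: indicator_poly_def coeff_sum)

lemma ipoly_indicator_poly: "ipoly (indicator_poly A) x = power_sum x A"
  unfolding indicator_poly_def power_sum_def
  by (induction A rule: infinite_finite_induct) (simp_all add: ipoly_add map_poly_monom poly_monom)

lemma algebraic_int_if_power_sums_eq:
  fixes x :: "'a::field_char_0"
  assumes "finite A" "finite B" "A \<noteq> B" "power_sum x A = power_sum x B"
  shows "algebraic_int x"
proof -
  define S where "S = indicator_poly A - indicator_poly B"
  have coeff: "coeff S i = (if i \<in> A then 1 else 0) - (if i \<in> B then 1 else 0)" for i
    using assms(1,2) by (simp add: S_def coeff_indicator_poly)
  obtain i where "i \<in> A \<longleftrightarrow> i \<notin> B" using assms(3) by blast
  then have "S \<noteq> 0" using coeff[of i] by auto
  then have "lead_coeff S = 1 \<or> lead_coeff S = -1"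
    using leading_coeff_0_iff[of S] by (auto simp: coeff split: if_splits)
  then have "lead_coeff (smult (lead_coeff S) S) = 1" by auto
  moreover have "ipoly (smult (lead_coeff S) S) x = 0"
    using assms(4) by (simp add: S_def ipoly_smult ipoly_diff ipoly_indicator_poly)
  ultimately show ?thesis unfolding algebraic_int_altdef_ipoly by blast
qed

lemma greedy_power_sum_below:
  fixes q t :: real
  assumes q: "1 < q" "q ^ m \<le> 2" and "r < m" and "0 \<le> t" "t \<le> q ^ (m * K + r)"
  shows "\<exists>A\<subseteq>{k. k mod m = r \<and> k < m * K + r}. power_sum q A \<in> {t - q ^ r..t}"
  using assms(4,5)
proof (induction K arbitrary: t)
  case 0
  then show ?case by (intro exI[of _ "{}"]) (simp add: power_sum_def)
next
  case (Suc K)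
  show ?case
  proof (cases "t \<le> q ^ (m * K + r)")
    case True
    then obtain A where "A \<subseteq> {k. k mod m = r \<and> k < m * K + r}" "power_sum q A \<in> {t - q ^ r..t}"
      using Suc.IH Suc.prems(1) by blast
    then show ?thesis by (intro exI[of _ A]) auto
  next
    case False
    have "t \<le> q ^ m * q ^ (m * K + r)" using Suc.prems(2) by (simp add: algebra_simps power_add)
    also have "\<dots> \<le> 2 * q ^ (m * K + r)" using q by (intro mult_right_mono) auto
    finally obtain A where A: "A \<subseteq> {k. k mod m = r \<and> k < m * K + r}"
        "power_sum q A \<in> {t - q ^ (m * K + r) - q ^ r..t - q ^ (m * K + r)}"
      using Suc.IH[of "t - q ^ (m * K + r)"] False by auto
    then have "finite A" "m * K + r \<notin> A" by (auto intro: finite_subset)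
    then have "power_sum q (insert (m * K + r) A) = q ^ (m * K + r) + power_sum q A"
      by (simp add: power_sum_def)
    then show ?thesis
      using A \<open>r < m\<close> by (intro exI[of _ "insert (m * K + r) A"]) auto
  qed
qed

lemma greedy_power_sum:
  fixes q t :: real
  assumes q: "1 < q" "q ^ m \<le> 2" and "r < m" and "0 \<le> t"
  obtains A where "A \<in> Fpow {k. k mod m = r}" "\<bar>power_sum q A - t\<bar> \<le> 2"
proof -
  obtain K where "t < q ^ K" using real_arch_pow[OF q(1)] by blast
  also have "\<dots> \<le> q ^ (m * K + r)" using q(1) \<open>r < m\<close> by (intro power_increasing) (auto simp: trans_le_add1)
  finally have "t \<le> q ^ (m * K + r)" by simp
  then obtain A where A: "A \<subseteq> {k. k mod m = r \<and> k < m * K + r}" "power_sum q A \<in> {t - q ^ r..t}"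
    using greedy_power_sum_below[OF q \<open>r < m\<close> \<open>0 \<le> t\<close>] by blast
  have "q ^ r \<le> q ^ m" using q(1) \<open>r < m\<close> by (intro power_increasing) auto
  then show ?thesis using A q(2) by (intro that[of A]) (auto simp: Fpow_def intro: finite_subset)
qed

lemma uniform_discrete_bounded_imp_finite:
  fixes S :: "'a::heine_borel set"
  assumes "uniform_discrete S" "bounded S"
  shows "finite S"
  using assms uniform_discrete_imp_closed uniform_discrete_imp_discrete
  by (metis compact_eq_bounded_closed discrete_compact_finite_iff)

lemma quasi_additive_mult:
  fixes u :: "nat \<Rightarrow> 'a::real_normed_vector"
  assumes quasi_additive: "\<And>m n. norm (u (m + n) - u m - u n) \<le> C"
  shows "norm (u (m * n) - real m *\<^sub>R u n) \<le> (real m + 1) * C"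
proof (induction m)
  case 0
  show ?case using quasi_additive[of 0 0] by simp
next
  case (Suc m)
  have "u (Suc m * n) - real (Suc m) *\<^sub>R u n
      = (u (n + m * n) - u n - u (m * n)) + (u (m * n) - real m *\<^sub>R u n)"
    by (simp add: algebra_simps)
  also have "norm \<dots> \<le> C + (real m + 1) * C"
    by (intro norm_triangle_mono quasi_additive Suc)
  finally show ?case by (simp add: algebra_simps)
qed

lemma quasi_additive_near_quotient:
  fixes u :: "nat \<Rightarrow> 'a::real_normed_vector"
  assumes quasi_additive: "\<And>m n. norm (u (m + n) - u m - u n) \<le> C" and "0 < m"
  shows "norm (u n - real n *\<^sub>R (u m /\<^sub>R real m)) \<le> C + (real n + 2) * C / real m"
proof -
  have "real m *\<^sub>R u n - real n *\<^sub>R u m = (u (n * m) - real n *\<^sub>R u m) - (u (m * n) - real m *\<^sub>R u n)"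
    by (simp add: mult.commute)
  also have "norm \<dots> \<le> (real n + 1) * C + (real m + 1) * C"
    by (intro order_trans[OF norm_triangle_ineq4] add_mono quasi_additive_mult quasi_additive)
  finally have "norm (real m *\<^sub>R u n - real n *\<^sub>R u m) \<le> (real m + real n + 2) * C"
    by (simp add: algebra_simps)
  moreover have "u n - real n *\<^sub>R (u m /\<^sub>R real m) = (real m *\<^sub>R u n - real n *\<^sub>R u m) /\<^sub>R real m"
    using \<open>0 < m\<close> by (simp add: scaleR_diff_right)
  ultimately have "norm (u n - real n *\<^sub>R (u m /\<^sub>R real m)) \<le> (real m + real n + 2) * C / real m"
    by (simp add: divide_inverse_commute mult_left_mono)
  then show ?thesis using \<open>0 < m\<close> by (simp add: field_simps)
qed

lemma quasi_additive_quotients_Cauchy: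
  fixes u :: "nat \<Rightarrow> 'a::real_normed_vector"
  assumes quasi_additive: "\<And>m n. norm (u (m + n) - u m - u n) \<le> C"
  shows "Cauchy (\<lambda>n. u n /\<^sub>R real n)"
proof (rule metric_CauchyI)
  have "0 \<le> C" using order_trans[OF norm_ge_zero quasi_additive] .
  fix e :: real assume "0 < e"
  then obtain M :: nat where M: "4 * C / e < real M" using reals_Archimedean2 by blast
  moreover have "0 \<le> 4 * C / e" using \<open>0 \<le> C\<close> \<open>0 < e\<close> by simp
  ultimately have "0 < real M" by linarith
  show "\<exists>M. \<forall>m\<ge>M. \<forall>n\<ge>M. dist (u m /\<^sub>R real m) (u n /\<^sub>R real n) < e"
  proof (intro exI allI impI)
    fix m n assume mn: "M \<le> m" "M \<le> n"
    then have pos: "1 \<le> real m" "1 \<le> real n" using \<open>0 < real M\<close> by auto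
    define D where "D = dist (u m /\<^sub>R real m) (u n /\<^sub>R real n)"
    have "u n - real n *\<^sub>R (u m /\<^sub>R real m) = real n *\<^sub>R (u n /\<^sub>R real n - u m /\<^sub>R real m)"
      using pos by (simp add: scaleR_diff_right)
    then have "real n * D \<le> C + (real n + 2) * C / real m"
      using quasi_additive_near_quotient[of u C m n, OF quasi_additive] pos
      by (simp add: D_def dist_norm norm_minus_commute)
    also have "\<dots> \<le> real n * (C / real n + 3 * (C / real m))"
      using pos \<open>0 \<le> C\<close> by (simp add: field_simps mult_left_mono)
    finally have "D \<le> C / real n + 3 * (C / real m)" using pos by simp
    also have "\<dots> \<le> C / real M + 3 * (C / real M)"
      using mn \<open>0 \<le> C\<close> \<open>0 < real M\<close> by (intro add_mono mult_left_mono divide_left_mono) auto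
    also have "\<dots> < e" using M \<open>0 < real M\<close> \<open>0 < e\<close> by (simp add: field_simps)
    finally show "dist (u m /\<^sub>R real m) (u n /\<^sub>R real n) < e" unfolding D_def .
  qed
qed

text \<open>Hyers' stability theorem on the natural numbers; the slope is the limit of \<open>u n / n\<close>.\<close>

lemma quasi_additive_near_linear:
  fixes u :: "nat \<Rightarrow> 'a::banach"
  assumes quasi_additive: "\<And>m n. norm (u (m + n) - u m - u n) \<le> C"
  obtains c where "\<And>n. norm (u n - real n *\<^sub>R c) \<le> C"
proof -
  obtain c where c: "(\<lambda>n. u n /\<^sub>R real n) \<longlonglongrightarrow> c"
    using quasi_additive_quotients_Cauchy[of u C, OF quasi_additive] Cauchy_convergent convergent_def by blast
  have "norm (u n - real n *\<^sub>R c) \<le> C" for n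
  proof (rule tendsto_le[OF sequentially_bot])
    show "(\<lambda>m. norm (u n - real n *\<^sub>R (u m /\<^sub>R real m))) \<longlonglongrightarrow> norm (u n - real n *\<^sub>R c)"
      by (intro tendsto_norm tendsto_diff tendsto_scaleR tendsto_const c)
    show "(\<lambda>m. C + (real n + 2) * C / real m) \<longlonglongrightarrow> C"
      using tendsto_add[OF tendsto_const[of C] lim_const_over_n[of "(real n + 2) * C"]] by simp
    show "\<forall>\<^sub>F m in sequentially. norm (u n - real n *\<^sub>R (u m /\<^sub>R real m)) \<le> C + (real n + 2) * C / real m"
      using eventually_gt_at_top[of 0]
      by eventually_elim (rule quasi_additive_near_quotient[OF quasi_additive])
  qed
  then show ?thesis by (rule that)
qed

lemma bounded_finite_sums_tendsto_0:
  fixes f :: "nat \<Rightarrow> 'a::euclidean_space"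
  assumes "\<And>K. finite K \<Longrightarrow> norm (sum f K) \<le> C"
  shows "f \<longlonglongrightarrow> 0"
proof -
  have "(\<Sum>k<N. norm (f k)) \<le> 2 * real DIM('a) * C" for N
    using assms finite_subset by (intro sum_norm_allsubsets_bound) auto
  then have "summable (\<lambda>k. norm (f k))" by (intro summableI_nonneg_bounded) auto
  then show ?thesis by (rule summable_LIMSEQ_zero[OF summable_norm_cancel])
qed

definition power_sum_diff :: "'a::comm_ring_1 \<Rightarrow> nat set \<times> nat set \<Rightarrow> 'a" where
  "power_sum_diff x P = power_sum x (fst P) - power_sum x (snd P)"

lemma power_sum_diff_Pair [simp]: "power_sum_diff x (A, B) = power_sum x A - power_sum x B"
  by (simp add: power_sum_diff_def)

lemma power_sum_diff_diff:
  assumes "I \<inter> J = {}" "P \<in> Fpow I \<times> Fpow J" "P' \<in> Fpow I \<times> Fpow J"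
  shows "power_sum_diff x P - power_sum_diff x P'
    = power_sum x (fst P \<union> snd P') - power_sum x (fst P' \<union> snd P)"
proof -
  have "fst P \<inter> snd P' = {}" "fst P' \<inter> snd P = {}" using assms unfolding Fpow_def mem_Times_iff by blast+
  then show ?thesis using assms(2,3)
    by (simp add: Fpow_def mem_Times_iff power_sum_diff_def power_sum_Un_disjoint)
qed

locale discrete_spectrum =
  fixes q :: real
  assumes q_gt_1: "1 < q" and q_cube_le_2: "q ^ 3 \<le> 2" and discrete: "uniform_discrete (spectrum q)"
begin

lemma finite_bounded_differences:
  assumes "I \<inter> J = {}"
  shows "finite {d \<in> power_sum_diff q ` (Fpow I \<times> Fpow J). \<bar>d\<bar> \<le> C}"
proof (rule uniform_discrete_bounded_imp_finite)
  obtain e where e: "0 < e" "\<And>x y. x \<in> spectrum q \<Longrightarrow> y \<in> spectrum q \<Longrightarrow> dist x y < e \<Longrightarrow> x = y"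
    using discrete unfolding uniform_discrete_def by blast
  have "d = d'" if mem: "d \<in> power_sum_diff q ` (Fpow I \<times> Fpow J)" "d' \<in> power_sum_diff q ` (Fpow I \<times> Fpow J)"
    and near: "dist d d' < e" for d d'
  proof -
    obtain P P' where P: "P \<in> Fpow I \<times> Fpow J" "P' \<in> Fpow I \<times> Fpow J"
      and d: "d = power_sum_diff q P" "d' = power_sum_diff q P'"
      using mem by blast
    have "fst P \<union> snd P' \<in> Fpow UNIV" "fst P' \<union> snd P \<in> Fpow UNIV" using P by (auto simp: Fpow_def)
    moreover have "dist (power_sum q (fst P \<union> snd P')) (power_sum q (fst P' \<union> snd P)) < e"
      using near power_sum_diff_diff[OF assms P, of q] by (simp add: d dist_real_def)
    ultimately have "power_sum q (fst P \<union> snd P') = power_sum q (fst P' \<union> snd P)"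
      using e(2) unfolding spectrum_def by blast
    then show ?thesis using power_sum_diff_diff[OF assms P, of q] by (simp add: d)
  qed
  then show "uniform_discrete {d \<in> power_sum_diff q ` (Fpow I \<times> Fpow J). \<bar>d\<bar> \<le> C}"
    using e(1) unfolding uniform_discrete_def by blast
  show "bounded {d \<in> power_sum_diff q ` (Fpow I \<times> Fpow J). \<bar>d\<bar> \<le> C}"
    by (auto simp: bounded_iff)
qed

lemma residue_class_approximants:
  obtains s where "\<And>r n. r < 3 \<Longrightarrow> s r n \<in> Fpow {k. k mod 3 = r}"
    "\<And>r n. r < 3 \<Longrightarrow> \<bar>power_sum q (s r n) - real n\<bar> \<le> 2"
proof -
  define s where "s r n = (SOME A. A \<in> Fpow {k. k mod 3 = r} \<and> \<bar>power_sum q A - real n\<bar> \<le> 2)" for r n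
  have "s r n \<in> Fpow {k. k mod 3 = r} \<and> \<bar>power_sum q (s r n) - real n\<bar> \<le> 2" if "r < 3" for r n
    unfolding s_def
    by (rule someI_ex) (metis greedy_power_sum[OF q_gt_1 q_cube_le_2 that] of_nat_0_le_iff)
  then show ?thesis by (intro that) blast+
qed

lemma algebraic_int_base: "algebraic_int q"
proof -
  let ?I = "{k::nat. k mod 3 = 0}" and ?J = "{k::nat. k mod 3 = 1}"
  have disjoint: "?I \<inter> ?J = {}" by auto
  have "\<exists>B\<in>Fpow ?J. \<bar>power_sum q B - q ^ (3 * n)\<bar> \<le> 2" for n
    using greedy_power_sum[OF q_gt_1 q_cube_le_2, of 1 "q ^ (3 * n)"] q_gt_1 by auto
  then obtain B where B: "\<And>n. B n \<in> Fpow ?J" "\<And>n. \<bar>power_sum q (B n) - q ^ (3 * n)\<bar> \<le> 2"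
    by metis
  define P where "P n = ({3 * n}, B n)" for n
  have P: "P n \<in> Fpow ?I \<times> Fpow ?J" for n using B(1) by (simp add: P_def Fpow_def)
  have "\<bar>power_sum_diff q (P n)\<bar> \<le> 2" for n
    using B(2)[of n] by (simp add: P_def power_sum_def abs_minus_commute)
  then have "range (\<lambda>n. power_sum_diff q (P n)) \<subseteq> {d \<in> power_sum_diff q ` (Fpow ?I \<times> Fpow ?J). \<bar>d\<bar> \<le> 2}"
    using P by blast
  then have "finite (range (\<lambda>n. power_sum_diff q (P n)))"
    using finite_bounded_differences[OF disjoint] by (rule finite_subset)
  then have "\<not> inj (\<lambda>n. power_sum_diff q (P n))" using finite_imageD by fastforce
  then obtain m n where mn: "power_sum_diff q (P m) = power_sum_diff q (P n)" "m \<noteq> n"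
    by (auto simp: inj_on_def)
  have "power_sum q ({3 * m} \<union> B n) = power_sum q ({3 * n} \<union> B m)"
    using power_sum_diff_diff[OF disjoint P P, of q m n] mn(1) by (simp add: P_def)
  moreover have "3 * m \<notin> {3 * n} \<union> B m" using mn(2) B(1)[of m] by (auto simp: Fpow_def)
  then have "{3 * m} \<union> B n \<noteq> {3 * n} \<union> B m" by blast
  moreover have "finite (B k)" for k using B(1)[of k] by (simp add: Fpow_def)
  ultimately show ?thesis
    by (intro algebraic_int_if_power_sums_eq[of "{3 * m} \<union> B n" "{3 * n} \<union> B m"]) simp_all
qed

end

locale discrete_spectrum_conjugate = discrete_spectrum +
  fixes \<alpha> :: complex
  assumes conjugate: "\<And>A B. finite A \<Longrightarrow> finite B \<Longrightarrow> power_sum q A = power_sum q B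
    \<Longrightarrow> power_sum \<alpha> A = power_sum \<alpha> B"
begin

lemma conjugate_differences_bounded:
  assumes "I \<inter> J = {}"
  shows "\<exists>D. \<forall>P \<in> Fpow I \<times> Fpow J. \<bar>power_sum_diff q P\<bar> \<le> C \<longrightarrow> cmod (power_sum_diff \<alpha> P) \<le> D"
proof -
  define \<P> where "\<P> = {P \<in> Fpow I \<times> Fpow J. \<bar>power_sum_diff q P\<bar> \<le> C}"
  have factor: "power_sum_diff \<alpha> P = power_sum_diff \<alpha> P'"
    if "P \<in> \<P>" "P' \<in> \<P>" "power_sum_diff q P = power_sum_diff q P'" for P P'
  proof -
    have P: "P \<in> Fpow I \<times> Fpow J" "P' \<in> Fpow I \<times> Fpow J" using that by (auto simp: \<P>_def)
    then have "power_sum \<alpha> (fst P \<union> snd P') = power_sum \<alpha> (fst P' \<union> snd P)"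
      using power_sum_diff_diff[OF assms P, of q] that(3)
      by (intro conjugate) (auto simp: Fpow_def)
    then show ?thesis using power_sum_diff_diff[OF assms P, of \<alpha>] by simp
  qed
  have "power_sum_diff \<alpha> P = power_sum_diff \<alpha> (inv_into \<P> (power_sum_diff q) (power_sum_diff q P))"
    if "P \<in> \<P>" for P
    using that by (intro factor) (simp_all add: inv_into_into f_inv_into_f)
  then have "power_sum_diff \<alpha> ` \<P>
      \<subseteq> (\<lambda>d. power_sum_diff \<alpha> (inv_into \<P> (power_sum_diff q) d)) ` power_sum_diff q ` \<P>" by auto
  moreover have "power_sum_diff q ` \<P> \<subseteq> {d \<in> power_sum_diff q ` (Fpow I \<times> Fpow J). \<bar>d\<bar> \<le> C}"
    by (auto simp: \<P>_def)
  then have "finite (power_sum_diff q ` \<P>)"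
    using finite_bounded_differences[OF assms] by (rule finite_subset)
  ultimately have "bounded (power_sum_diff \<alpha> ` \<P>)"
    by (meson finite_imageI finite_imp_bounded finite_subset)
  then show ?thesis by (auto simp: bounded_iff \<P>_def)
qed

text \<open>The residue classes modulo 3 are disjoint, so the class 2 approximation of \<open>m + n\<close> can be compared
  with the sum of the class 0 approximation of \<open>m\<close> and the class 1 approximation of \<open>n\<close>.\<close>

lemma conjugate_quasi_additive:
  obtains u D where "\<And>m n. cmod (u (m + n) - u m - u n) \<le> 3 * D"
    "\<And>r A n. r < 2 \<Longrightarrow> A \<in> Fpow {k. k mod 3 = r} \<Longrightarrow> \<bar>power_sum q A - real n\<bar> \<le> 2
      \<Longrightarrow> cmod (power_sum \<alpha> A - u n) \<le> D"
proof -
  let ?I = "{k::nat. k mod 3 \<noteq> 2}" and ?J = "{k::nat. k mod 3 = 2}"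
  have "?I \<inter> ?J = {}" by auto
  then obtain D where D: "\<And>A B. A \<in> Fpow ?I \<Longrightarrow> B \<in> Fpow ?J \<Longrightarrow> \<bar>power_sum q A - power_sum q B\<bar> \<le> 6
      \<Longrightarrow> cmod (power_sum \<alpha> A - power_sum \<alpha> B) \<le> D"
    using conjugate_differences_bounded[of ?I ?J 6] by fastforce
  obtain s where s: "\<And>r n. r < 3 \<Longrightarrow> s r n \<in> Fpow {k. k mod 3 = r}"
      "\<And>r n. r < 3 \<Longrightarrow> \<bar>power_sum q (s r n) - real n\<bar> \<le> 2"
    using residue_class_approximants by metis
  define u where "u n = power_sum \<alpha> (s 2 n)" for n
  have near: "cmod (power_sum \<alpha> A - u n) \<le> D"
    if "r < 2" "A \<in> Fpow {k. k mod 3 = r}" "\<bar>power_sum q A - real n\<bar> \<le> 2" for r A n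
  proof -
    have "A \<in> Fpow ?I" "s 2 n \<in> Fpow ?J" using that(1,2) s(1)[of 2 n] by (auto simp: Fpow_def)
    then show ?thesis using that(3) s(2)[of 2 n] unfolding u_def by (intro D) auto
  qed
  have "cmod (u (m + n) - u m - u n) \<le> 3 * D" for m n
  proof -
    have Un: "power_sum x (s 0 m \<union> s 1 n) = power_sum x (s 0 m) + power_sum x (s 1 n)"
      for x :: "'b::comm_ring_1"
      using s(1)[of 0 m] s(1)[of 1 n] by (intro power_sum_Un_disjoint) (fastforce simp: Fpow_def)+
    have sum: "cmod (power_sum \<alpha> (s 0 m \<union> s 1 n) - u (m + n)) \<le> D"
      unfolding u_def
    proof (rule D)
      show "s 0 m \<union> s 1 n \<in> Fpow ?I" using s(1)[of 0 m] s(1)[of 1 n] by (auto simp: Fpow_def)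
      show "s 2 (m + n) \<in> Fpow ?J" using s(1) by simp
      show "\<bar>power_sum q (s 0 m \<union> s 1 n) - power_sum q (s 2 (m + n))\<bar> \<le> 6"
        unfolding Un using s(2)[of 0 m] s(2)[of 1 n] s(2)[of 2 "m + n"] by simp
    qed
    have summand: "cmod (power_sum \<alpha> (s 0 m) - u m) \<le> D" "cmod (power_sum \<alpha> (s 1 n) - u n) \<le> D"
      using s[of 0 m] s[of 1 n] near[of 0] near[of 1] by auto
    have "u (m + n) - u m - u n = (power_sum \<alpha> (s 0 m) - u m) + (power_sum \<alpha> (s 1 n) - u n)
        - (power_sum \<alpha> (s 0 m \<union> s 1 n) - u (m + n))" unfolding Un by simp
    also have "cmod \<dots> \<le> (D + D) + D"
      by (rule order_trans[OF norm_triangle_ineq4 add_mono[OF norm_triangle_mono[OF summand] sum]])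
    finally show ?thesis by simp
  qed
  then show ?thesis using near by (rule that)
qed

lemma conjugate_near_linear:
  obtains c C where "\<And>r A. r < 2 \<Longrightarrow> A \<in> Fpow {k. k mod 3 = r}
    \<Longrightarrow> cmod (power_sum \<alpha> A - c * of_real (power_sum q A)) \<le> C"
proof -
  obtain u D where "\<And>m n. cmod (u (m + n) - u m - u n) \<le> 3 * D"
    and near: "\<And>r A n. r < 2 \<Longrightarrow> A \<in> Fpow {k. k mod 3 = r} \<Longrightarrow> \<bar>power_sum q A - real n\<bar> \<le> 2
      \<Longrightarrow> cmod (power_sum \<alpha> A - u n) \<le> D"
    using conjugate_quasi_additive by metis
  then obtain c where c: "\<And>n. cmod (u n - real n *\<^sub>R c) \<le> 3 * D"
    using quasi_additive_near_linear[of u] by metis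
  have "cmod (power_sum \<alpha> A - c * of_real (power_sum q A)) \<le> D + 3 * D + cmod c"
    if A: "r < 2" "A \<in> Fpow {k. k mod 3 = r}" for r A
  proof -
    define n where "n = nat \<lfloor>power_sum q A\<rfloor>"
    have "0 \<le> power_sum q A" unfolding power_sum_def using q_gt_1 by (intro sum_nonneg) auto
    then have n: "\<bar>power_sum q A - real n\<bar> \<le> 1" unfolding n_def by linarith
    then have rounding: "cmod ((real n - power_sum q A) *\<^sub>R c) \<le> cmod c"
      by (simp add: abs_minus_commute mult_left_le_one_le)
    have "power_sum \<alpha> A - c * of_real (power_sum q A)
        = (power_sum \<alpha> A - u n) + (u n - real n *\<^sub>R c) + (real n - power_sum q A) *\<^sub>R c"
      by (simp add: algebra_simps scaleR_conv_of_real)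
    also have "cmod \<dots> \<le> D + 3 * D + cmod c"
      using A n by (intro norm_triangle_mono near[OF A] c rounding) simp
    finally show ?thesis .
  qed
  then show ?thesis by (rule that)
qed

lemma conjugate_norm_less_1:
  assumes "\<alpha> \<noteq> of_real q"
  shows "cmod \<alpha> < 1"
proof (rule ccontr)
  obtain c C where near: "\<And>r A. r < 2 \<Longrightarrow> A \<in> Fpow {k. k mod 3 = r}
      \<Longrightarrow> cmod (power_sum \<alpha> A - c * of_real (power_sum q A)) \<le> C"
    using conjugate_near_linear by metis
  define f where "f r k = \<alpha> ^ (3 * k + r) - c * of_real q ^ (3 * k + r)" for r k
  have f: "f r \<longlonglongrightarrow> 0" if "r < 2" for r
  proof (rule bounded_finite_sums_tendsto_0)
    fix K :: "nat set" assume "finite K"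
    then have "(\<lambda>k. 3 * k + r) ` K \<in> Fpow {k. k mod 3 = r}" using that by (auto simp: Fpow_def)
    from near[OF that this] show "cmod (sum (f r) K) \<le> C"
      by (simp add: power_sum_affine_image f_def sum_subtractf sum_distrib_left)
  qed
  have "(\<lambda>k. f 1 k - of_real q * f 0 k) \<longlonglongrightarrow> 0 - of_real q * 0"
    by (intro tendsto_intros f) auto
  moreover have "f 1 k - of_real q * f 0 k = \<alpha> ^ (3 * k) * (\<alpha> - of_real q)" for k
    by (simp add: f_def algebra_simps)
  ultimately have lim: "(\<lambda>k. cmod (\<alpha> ^ (3 * k) * (\<alpha> - of_real q))) \<longlonglongrightarrow> 0"
    by (simp add: tendsto_norm_zero)
  assume "\<not> cmod \<alpha> < 1"
  then have "cmod (\<alpha> - of_real q) \<le> cmod (\<alpha> ^ (3 * k) * (\<alpha> - of_real q))" for k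
    by (simp add: norm_mult norm_power mult_le_cancel_right1)
  then have "cmod (\<alpha> - of_real q) \<le> 0" by (intro LIMSEQ_le_const[OF lim]) blast
  with assms show False by simp
qed

end

theorem pisot_if_uniform_discrete_spectrum:
  assumes "1 < q" "q ^ 3 \<le> 2" "uniform_discrete (spectrum q)"
  shows "pisot q"
proof -
  interpret discrete_spectrum q using assms by unfold_locales
  have "cmod \<alpha> < 1" if conj: "\<forall>S. ipoly S q = 0 \<longrightarrow> ipoly S \<alpha> = 0" and "\<alpha> \<noteq> of_real q" for \<alpha> :: complex
  proof -
    have "power_sum \<alpha> A = power_sum \<alpha> B" if "power_sum q A = power_sum q B" for A B
      using conj[rule_format, of "indicator_poly A - indicator_poly B"] that
      by (simp add: ipoly_diff ipoly_indicator_poly)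
    then interpret discrete_spectrum_conjugate q \<alpha> by unfold_locales
    show ?thesis using \<open>\<alpha> \<noteq> of_real q\<close> by (rule conjugate_norm_less_1)
  qed
  then show ?thesis using assms(1) algebraic_int_base by (auto simp: pisot_def)
qed

corollary small_power_sum_difference:
  fixes q :: real
  assumes q: "1 < q" "q < 1 + 1/100" and "0 < \<epsilon>"
  obtains A B where "finite A" "finite B" "0 < power_sum q A - power_sum q B"
    "power_sum q A - power_sum q B < \<epsilon>"
proof -
  have "q ^ 3 \<le> (1 + 1/100) ^ 3" using q by (intro power_mono) auto
  then have "q ^ 3 \<le> 2" by (simp add: power3_eq_cube)
  then have "\<not> uniform_discrete (spectrum q)"
    using pisot_if_uniform_discrete_spectrum[of q] pisot_ge[of q] q by auto
  then obtain A B where close: "finite A" "finite B" "dist (power_sum q A) (power_sum q B) < \<epsilon>"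
      "power_sum q A \<noteq> power_sum q B"
    using \<open>0 < \<epsilon>\<close> unfolding uniform_discrete_def spectrum_def Fpow_def by auto
  then show ?thesis
    using that[of A B] that[of B A] by (cases "power_sum q B < power_sum q A") (auto simp: dist_real_def)
qed

section \<open>Nets of power sums\<close>

definition power_net :: "real \<Rightarrow> real \<Rightarrow> real \<Rightarrow> bool" where
  "power_net q \<epsilon> R \<longleftrightarrow> (\<exists>K \<tau>. \<forall>t\<in>{0..R}. \<exists>E\<subseteq>{..<K}. \<bar>\<tau> + t - power_sum q E\<bar> \<le> \<epsilon>)"

lemma power_net_mono: "power_net q \<epsilon> R \<Longrightarrow> R' \<le> R \<Longrightarrow> power_net q \<epsilon> R'"
  unfolding power_net_def by (meson atLeastAtMost_iff order_trans)

lemma power_sum_shift: "power_sum x ((+) L ` A) = x ^ L * power_sum x A"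
  by (simp add: power_sum_def sum.reindex sum_distrib_left power_add)

lemma ex_power_scaling:
  fixes q s c :: real
  assumes q: "1 < q" "q \<le> 2" and "0 < s" "q ^ K * s \<le> c"
  obtains L where "K < L" "c < q ^ L * s" "q ^ L * s \<le> 2 * c"
proof -
  obtain N where "c / s < q ^ N" using real_arch_pow[OF q(1)] by blast
  then have "c < q ^ N * s" using \<open>0 < s\<close> by (simp add: pos_divide_less_eq)
  then obtain L where L: "c < q ^ L * s" and least: "\<And>k. k < L \<Longrightarrow> q ^ k * s \<le> c"
    using exists_least_iff[of "\<lambda>k. c < q ^ k * s"] by (auto simp: not_less)
  have "K < L"
  proof (rule ccontr)
    assume "\<not> K < L"
    then have "q ^ L * s \<le> q ^ K * s" using q \<open>0 < s\<close> by (intro mult_right_mono power_increasing) auto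
    then show False using L assms(4) by simp
  qed
  have "0 \<le> c" using assms by (meson mult_nonneg_nonneg less_imp_le order_trans zero_le_power zero_le_one)
  have "q ^ L * s = q * (q ^ (L - 1) * s)" using \<open>K < L\<close> by (cases L) auto
  also have "\<dots> \<le> 2 * c" using q least[of "L - 1"] \<open>K < L\<close> \<open>0 \<le> c\<close> \<open>0 < s\<close> by (intro mult_mono) auto
  finally show ?thesis using that \<open>K < L\<close> L by blast
qed

text \<open>Multiplying a small difference of power sums by \<open>q ^ L\<close> gives a step \<open>g\<close> between \<open>\<epsilon> / 2\<close> and \<open>\<epsilon>\<close>
  that uses only exponents above \<open>K\<close>; switching it on extends the net by \<open>\<epsilon> / 2\<close>.\<close>

lemma power_net_extend:
  assumes q: "1 < q" "q < 1 + 1/100" and \<epsilon>: "0 < \<epsilon>" "\<epsilon> \<le> R" and "power_net q \<epsilon> R"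
  shows "power_net q \<epsilon> (R + \<epsilon> / 2)"
proof -
  obtain K \<tau> where net: "\<And>t. t \<in> {0..R} \<Longrightarrow> \<exists>E\<subseteq>{..<K}. \<bar>\<tau> + t - power_sum q E\<bar> \<le> \<epsilon>"
    using assms(5) unfolding power_net_def by blast
  obtain A B where small: "finite A" "finite B" "0 < power_sum q A - power_sum q B"
      "power_sum q A - power_sum q B < \<epsilon> / 2 / q ^ K"
    using small_power_sum_difference[OF q, of "\<epsilon> / 2 / q ^ K"] \<epsilon> q by auto
  have "(power_sum q A - power_sum q B) * q ^ K < \<epsilon> / 2"
    using small(4) q by (subst pos_less_divide_eq[symmetric]) auto
  then have "q ^ K * (power_sum q A - power_sum q B) \<le> \<epsilon> / 2" by (simp only: mult.commute less_imp_le)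
  then obtain L where L: "K < L" "\<epsilon> / 2 < q ^ L * (power_sum q A - power_sum q B)"
      "q ^ L * (power_sum q A - power_sum q B) \<le> \<epsilon>"
    using ex_power_scaling[of q "power_sum q A - power_sum q B" K "\<epsilon> / 2"] small(3) q by auto
  define A' B' where "A' = (+) L ` A" and "B' = (+) L ` B"
  define g where "g = power_sum q A' - power_sum q B'"
  have g: "\<epsilon> / 2 < g" "g \<le> \<epsilon>"
    using L by (simp_all add: g_def A'_def B'_def power_sum_shift right_diff_distrib)
  have Un: "power_sum q (E \<union> A') = power_sum q E + power_sum q A'"
      "power_sum q (E \<union> B') = power_sum q E + power_sum q B'" if "E \<subseteq> {..<K}" for E
    using that small(1,2) L(1) finite_subset[OF that] unfolding A'_def B'_def
    by (auto intro!: power_sum_Un_disjoint)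
  have "finite ({..<K} \<union> A' \<union> B')" using small by (simp add: A'_def B'_def)
  then obtain K' where bound: "{..<K} \<union> A' \<union> B' \<subseteq> {..<K'}" by (auto simp: finite_nat_iff_bounded)
  have "\<exists>E\<subseteq>{..<K'}. \<bar>(\<tau> + power_sum q B') + t - power_sum q E\<bar> \<le> \<epsilon>" if t: "t \<in> {0..R + \<epsilon> / 2}" for t
  proof (cases "t \<le> R")
    case True
    then obtain E where "E \<subseteq> {..<K}" "\<bar>\<tau> + t - power_sum q E\<bar> \<le> \<epsilon>" using net[of t] t by auto
    then show ?thesis using bound by (intro exI[of _ "E \<union> B'"]) (auto simp: Un)
  next
    case False
    then obtain E where "E \<subseteq> {..<K}" "\<bar>\<tau> + (t - g) - power_sum q E\<bar> \<le> \<epsilon>"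
      using net[of "t - g"] t g \<epsilon> by auto
    then show ?thesis using bound by (intro exI[of _ "E \<union> A'"]) (auto simp: Un g_def algebra_simps)
  qed
  then show ?thesis unfolding power_net_def by blast
qed

lemma power_net_exists:
  assumes q: "1 < q" "q < 1 + 1/100" and \<epsilon>: "0 < \<epsilon>"
  shows "power_net q \<epsilon> R"
proof -
  have net: "power_net q \<epsilon> (\<epsilon> + real M * (\<epsilon> / 2))" for M
  proof (induction M)
    case 0
    show ?case unfolding power_net_def
      by (intro exI[of _ 0] ballI exI[of _ "{}"]) (simp add: power_sum_def)
  next
    case (Suc M)
    have "power_net q \<epsilon> (\<epsilon> + real M * (\<epsilon> / 2) + \<epsilon> / 2)"
      using \<epsilon> by (intro power_net_extend[OF q \<epsilon> _ Suc]) simp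
    then show ?case by (simp add: field_simps)
  qed
  obtain M where "R / (\<epsilon> / 2) < real M" using reals_Archimedean2 by blast
  then have "R \<le> \<epsilon> + real M * (\<epsilon> / 2)" using \<epsilon> by (simp add: pos_divide_less_eq)
  then show ?thesis using power_net_mono net by blast
qed

section \<open>Greedy digits\<close>

lemma convex_combination_remove_weight:
  fixes S :: "'a::real_vector set"
  assumes S: "finite S" and u: "\<And>z. z \<in> S \<Longrightarrow> 0 \<le> u z" "sum u S = 1"
    and y: "y \<in> S" "\<theta> \<le> u y" and "\<theta> < 1"
  shows "\<exists>x'\<in>convex hull S. (\<Sum>z\<in>S. u z *\<^sub>R z) = \<theta> *\<^sub>R y + (1 - \<theta>) *\<^sub>R x'"
proof
  define u' where "u' z = (u z - (if z = y then \<theta> else 0)) / (1 - \<theta>)" for z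
  have "\<forall>z\<in>S. 0 \<le> u' z" using u(1) y(2) \<open>\<theta> < 1\<close> by (auto simp: u'_def)
  moreover have "sum u' S = 1"
    unfolding u'_def using u(2) S y(1) \<open>\<theta> < 1\<close> by (simp add: sum_subtractf flip: sum_divide_distrib)
  ultimately show "(\<Sum>z\<in>S. u' z *\<^sub>R z) \<in> convex hull S" unfolding convex_hull_finite[OF S] by blast
  have "(1 - \<theta>) *\<^sub>R (\<Sum>z\<in>S. u' z *\<^sub>R z) = (\<Sum>z\<in>S. u z *\<^sub>R z - (if z = y then \<theta> *\<^sub>R z else 0))"
    unfolding scaleR_sum_right scaleR_scaleR
    using \<open>\<theta> < 1\<close> by (intro sum.cong) (auto simp: u'_def scaleR_diff_left)
  then show "(\<Sum>z\<in>S. u z *\<^sub>R z) = \<theta> *\<^sub>R y + (1 - \<theta>) *\<^sub>R (\<Sum>z\<in>S. u' z *\<^sub>R z)"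
    using S y(1) by (simp add: sum_subtractf)
qed

lemma convex_hull_finite_split:
  fixes S :: "'a::real_vector set"
  assumes S: "finite S" "x \<in> convex hull S" and \<theta>: "0 \<le> \<theta>" "real (card S) * \<theta> \<le> 1"
  obtains y x' where "y \<in> S" "x' \<in> convex hull S" "x = \<theta> *\<^sub>R y + (1 - \<theta>) *\<^sub>R x'"
proof -
  have "S \<noteq> {}" using S(2) by auto
  then have "1 \<le> card S" using S(1) by (simp add: Suc_le_eq card_gt_0_iff)
  show ?thesis
  proof (cases "\<theta> < 1")
    case True
    obtain u where u: "\<And>z. z \<in> S \<Longrightarrow> 0 \<le> u z" "sum u S = 1" "(\<Sum>z\<in>S. u z *\<^sub>R z) = x"
      using S(2) unfolding convex_hull_finite[OF S(1)] by blast
    have "\<exists>y\<in>S. \<theta> \<le> u y"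
    proof (rule ccontr)
      assume "\<not> ?thesis"
      then have "sum u S < (\<Sum>z\<in>S. \<theta>)" using S(1) \<open>S \<noteq> {}\<close> by (intro sum_strict_mono) auto
      then show False using u(2) \<theta>(2) by simp
    qed
    then obtain y where "y \<in> S" "\<theta> \<le> u y" by blast
    then show ?thesis
      using convex_combination_remove_weight[OF S(1) u(1,2) _ _ True] u(3) that by metis
  next
    case False
    have "1 * \<theta> \<le> real (card S) * \<theta>" using \<open>1 \<le> card S\<close> \<theta>(1) by (intro mult_right_mono) auto
    then have "\<theta> = 1" using False \<theta>(2) by linarith
    then have "card S = 1" using \<theta>(2) \<open>1 \<le> card S\<close> by simp
    then obtain y where "S = {y}" by (rule card_1_singletonE)
    then show ?thesis using S(2) \<open>\<theta> = 1\<close> by (intro that[of y x]) auto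
  qed
qed

text \<open>Choosing the digits from the largest weight downwards keeps the remaining target inside the convex
  hull, so that only the total weight below \<open>k\<^sub>0\<close> enters the error.\<close>

lemma greedy_weighted_sum:
  fixes S :: "'a::euclidean_space set" and w :: "nat \<Rightarrow> real"
  assumes S: "finite S" and w: "\<And>j. 0 \<le> w j" "\<And>k. k\<^sub>0 \<le> k \<Longrightarrow> real (card S) * w k \<le> (\<Sum>j<Suc k. w j)"
    and "k\<^sub>0 \<le> m" "x \<in> convex hull S"
  shows "\<exists>s. (\<forall>j. s j \<in> S) \<and>
    norm ((\<Sum>j<m. w j) *\<^sub>R x - (\<Sum>j<m. w j *\<^sub>R s j)) \<le> (\<Sum>j<k\<^sub>0. w j) * diameter (convex hull S)"
  using assms(4,5)
proof (induction arbitrary: x rule: dec_induct)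
  case base
  then obtain y where y: "y \<in> S" by fastforce
  have "norm (x - y) \<le> diameter (convex hull S)"
    using diameter_bounded_bound[of "convex hull S" x y] base y S
    by (simp add: dist_norm hull_inc finite_imp_bounded_convex_hull)
  then have "norm ((\<Sum>j<k\<^sub>0. w j) *\<^sub>R (x - y)) \<le> (\<Sum>j<k\<^sub>0. w j) * diameter (convex hull S)"
    using w(1) by (simp add: sum_nonneg mult_left_mono)
  then show ?case
    using y by (intro exI[of _ "\<lambda>_. y"]) (simp add: scaleR_diff_right scaleR_sum_left)
next
  case (step m)
  define W \<theta> where "W = (\<Sum>j<Suc m. w j)" and "\<theta> = w m / W"
  have "0 \<le> (\<Sum>j<m. w j)" using w(1) by (simp add: sum_nonneg)
  then have W: "w m \<le> W" "0 \<le> W" using w(1)[of m] by (simp_all add: W_def)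
  have "real (card S) * w m \<le> W" using w(2)[OF step.hyps(1)] by (simp only: W_def)
  then have "0 \<le> \<theta>" "real (card S) * \<theta> \<le> 1"
    using w(1)[of m] W(2) by (simp_all add: \<theta>_def divide_le_eq)
  then obtain y x' where y: "y \<in> S" "x' \<in> convex hull S" "x = \<theta> *\<^sub>R y + (1 - \<theta>) *\<^sub>R x'"
    using convex_hull_finite_split[OF S step.prems] by metis
  have "W * \<theta> = w m" "W * (1 - \<theta>) = (\<Sum>j<m. w j)"
    using W w(1)[of m] by (auto simp: \<theta>_def W_def right_diff_distrib)
  then have Wx: "W *\<^sub>R x = w m *\<^sub>R y + (\<Sum>j<m. w j) *\<^sub>R x'" by (simp add: y(3) scaleR_add_right)
  obtain s where s: "\<forall>j. s j \<in> S"
      "norm ((\<Sum>j<m. w j) *\<^sub>R x' - (\<Sum>j<m. w j *\<^sub>R s j)) \<le> (\<Sum>j<k\<^sub>0. w j) * diameter (convex hull S)"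
    using step.IH[OF y(2)] by blast
  have "W *\<^sub>R x - (\<Sum>j<Suc m. w j *\<^sub>R (s(m := y)) j) = (\<Sum>j<m. w j) *\<^sub>R x' - (\<Sum>j<m. w j *\<^sub>R s j)"
    unfolding Wx by simp
  then show ?case using s y(1) unfolding W_def by (intro exI[of _ "s(m := y)"]) (simp only:, simp)
qed

lemma multiples_power_sum_dominates:
  fixes q :: real
  assumes q: "1 < q" and N: "1 \<le> N" "real N * (q ^ N - 1) \<le> 1/2" and k: "2 \<le> q ^ k"
  shows "real N * q ^ k \<le> (\<Sum>l<Suc (k div N). (q ^ N) ^ l)"
proof -
  have "1 < q ^ N" using q N(1) by (intro one_less_power) auto
  have "N * (k div N) + k mod N = k" "k mod N < N" using N(1) by auto
  then have "k \<le> N * Suc (k div N)" unfolding mult_Suc_right by linarith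
  then have "q ^ k \<le> (q ^ N) ^ Suc (k div N)" using q by (simp only: power_mult[symmetric] power_increasing)
  moreover have "real N * q ^ k * (q ^ N - 1) \<le> q ^ k / 2"
    using mult_right_mono[OF N(2), of "q ^ k"] q by (simp add: mult_ac)
  ultimately have "real N * q ^ k * (q ^ N - 1) \<le> (q ^ N) ^ Suc (k div N) - 1" using k by linarith
  then have "real N * q ^ k \<le> ((q ^ N) ^ Suc (k div N) - 1) / (q ^ N - 1)"
    using \<open>1 < q ^ N\<close> by (simp add: pos_le_divide_eq)
  also have "\<dots> = (\<Sum>l<Suc (k div N). (q ^ N) ^ l)"
    using \<open>1 < q ^ N\<close> by (simp only: geometric_sum[of "q ^ N" "Suc (k div N)"])
  finally show ?thesis .
qed

lemma masked_power_sum_dominates: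
  fixes q :: real
  assumes q: "1 < q" and N: "1 \<le> N" "real N * (q ^ N - 1) \<le> 1/2" and k: "2 \<le> q ^ k"
    and A: "\<And>l. N * l \<in> A"
  defines "w \<equiv> \<lambda>j. if j \<in> A then q ^ j else 0"
  shows "real N * w k \<le> (\<Sum>j<Suc k. w j)"
proof (cases "k \<in> A")
  case True
  have "real N * w k \<le> (\<Sum>l<Suc (k div N). (q ^ N) ^ l)"
    using True multiples_power_sum_dominates[OF q N k] by (simp add: w_def)
  also have "\<dots> = (\<Sum>j\<in>(\<lambda>l. N * l) ` {..<Suc (k div N)}. w j)"
    using N(1) A by (subst sum.reindex) (auto simp: w_def inj_on_def power_mult simp del: sum.lessThan_Suc)
  also have "\<dots> \<le> (\<Sum>j<Suc k. w j)"
  proof (rule sum_mono2)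
    have "N * l \<le> k" if "l \<le> k div N" for l
      using that N(1) by (simp add: less_eq_div_iff_mult_less_eq mult.commute)
    then show "(\<lambda>l. N * l) ` {..<Suc (k div N)} \<subseteq> {..<Suc k}" by (auto simp: less_Suc_eq_le)
  qed (use q in \<open>auto simp: w_def\<close>)
  finally show ?thesis .
next
  case False
  then show ?thesis using q by (simp add: w_def sum_nonneg del: sum.lessThan_Suc)
qed

lemma coarse_digits:
  fixes p :: "nat \<Rightarrow> 'a::euclidean_space" and q :: real
  assumes q: "1 < q" "real (n + 1) * (q ^ (n + 1) - 1) \<le> 1/2"
  obtains k\<^sub>0 R where "\<And>F m x. (\<And>l. (n + 1) * l \<notin> F) \<Longrightarrow> k\<^sub>0 \<le> m \<Longrightarrow> x \<in> convex hull (p ` {..n}) \<Longrightarrow>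
    \<exists>c. (\<forall>j. c j \<le> n) \<and> norm ((\<Sum>j\<in>{..<m} - F. q ^ j) *\<^sub>R x - (\<Sum>j\<in>{..<m} - F. q ^ j *\<^sub>R p (c j))) \<le> R"
proof -
  obtain k\<^sub>0 where k0: "2 < q ^ k\<^sub>0" using real_arch_pow[OF q(1)] by blast
  define D where "D = diameter (convex hull (p ` {..n}))"
  have "0 \<le> D" by (simp add: D_def diameter_ge_0 finite_imp_bounded_convex_hull)
  have "\<exists>c. (\<forall>j. c j \<le> n) \<and> norm ((\<Sum>j\<in>{..<m} - F. q ^ j) *\<^sub>R x - (\<Sum>j\<in>{..<m} - F. q ^ j *\<^sub>R p (c j)))
      \<le> (\<Sum>j<k\<^sub>0. q ^ j) * D"
    if F: "\<And>l. (n + 1) * l \<notin> F" and m: "k\<^sub>0 \<le> m" and x: "x \<in> convex hull (p ` {..n})" for F m x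
  proof -
    define w where "w j = (if j \<in> - F then q ^ j else 0)" for j
    have w: "0 \<le> w j" "w j \<le> q ^ j" for j using q(1) by (simp_all add: w_def)
    have "real (card (p ` {..n})) * w k \<le> (\<Sum>j<Suc k. w j)" if "k\<^sub>0 \<le> k" for k
    proof -
      have "2 \<le> q ^ k" using k0 power_increasing[OF that, of q] q(1) by linarith
      then have "real (n + 1) * w k \<le> (\<Sum>j<Suc k. w j)"
        unfolding w_def using q F by (intro masked_power_sum_dominates) auto
      moreover have "real (card (p ` {..n})) * w k \<le> real (n + 1) * w k"
        using card_image_le[of "{..n}" p] w(1) by (intro mult_right_mono) auto
      ultimately show ?thesis by linarith
    qed
    then obtain s where s: "\<forall>j. s j \<in> p ` {..n}"
        "norm ((\<Sum>j<m. w j) *\<^sub>R x - (\<Sum>j<m. w j *\<^sub>R s j)) \<le> (\<Sum>j<k\<^sub>0. w j) * D"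
      using greedy_weighted_sum[of "p ` {..n}" w k\<^sub>0 m x] w(1) m x unfolding D_def by blast
    then have "\<forall>j. \<exists>i\<le>n. s j = p i" by blast
    then obtain c where c: "\<And>j. c j \<le> n" "\<And>j. s j = p (c j)" by metis
    have "(\<Sum>j<m. w j) = (\<Sum>j\<in>{..<m} - F. q ^ j)"
        "(\<Sum>j<m. w j *\<^sub>R s j) = (\<Sum>j\<in>{..<m} - F. q ^ j *\<^sub>R p (c j))"
      unfolding w_def c(2) by (auto simp: sum.inter_restrict Diff_eq intro!: sum.cong)
    moreover have "(\<Sum>j<k\<^sub>0. w j) * D \<le> (\<Sum>j<k\<^sub>0. q ^ j) * D"
      using w(2) \<open>0 \<le> D\<close> by (intro mult_right_mono sum_mono)
    ultimately show ?thesis using s(2) c(1) by (intro exI[of _ c]) auto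
  qed
  then show ?thesis by (rule that)
qed

section \<open>Fine digits\<close>

lemma span_image_finite_sum:
  fixes v :: "'i \<Rightarrow> 'a::real_vector"
  assumes "finite I" "x \<in> span (v ` I)"
  shows "\<exists>u. x = (\<Sum>i\<in>I. u i *\<^sub>R v i)"
  using assms
proof (induction I arbitrary: x)
  case (insert i I)
  then obtain k where "x - k *\<^sub>R v i \<in> span (v ` I)" by (auto simp: span_breakdown_eq)
  then obtain u where "x - k *\<^sub>R v i = (\<Sum>j\<in>I. u j *\<^sub>R v j)" using insert.IH by blast
  moreover have "(\<Sum>j\<in>I. (u(i := k)) j *\<^sub>R v j) = (\<Sum>j\<in>I. u j *\<^sub>R v j)"
    using insert.hyps by (intro sum.cong) auto
  ultimately have "x = (\<Sum>j\<in>insert i I. (u(i := k)) j *\<^sub>R v j)"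
    using insert.hyps by (simp add: algebra_simps)
  then show ?case by blast
qed simp

lemma spanning_family_coordinates:
  fixes v :: "'i \<Rightarrow> 'a::euclidean_space"
  assumes I: "finite I" "span (v ` I) = UNIV"
  obtains g C where "\<And>h. h = (\<Sum>i\<in>I. g h i *\<^sub>R v i)" "\<And>h i. i \<in> I \<Longrightarrow> \<bar>g h i\<bar> \<le> C * norm h"
proof -
  have "\<exists>u. b = (\<Sum>i\<in>I. u i *\<^sub>R v i)" for b using span_image_finite_sum[OF I(1)] I(2) by blast
  then obtain \<beta> where \<beta>: "\<And>b. b = (\<Sum>i\<in>I. \<beta> b i *\<^sub>R v i)" by metis
  define g where "g h i = (\<Sum>b\<in>Basis. (h \<bullet> b) * \<beta> b i)" for h i
  define C where "C = (\<Sum>i\<in>I. \<Sum>b\<in>Basis. \<bar>\<beta> b i\<bar>)"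
  have "h = (\<Sum>i\<in>I. g h i *\<^sub>R v i)" for h
  proof -
    have "h = (\<Sum>b\<in>Basis. (h \<bullet> b) *\<^sub>R (\<Sum>i\<in>I. \<beta> b i *\<^sub>R v i))"
      by (simp add: euclidean_representation flip: \<beta>)
    also have "\<dots> = (\<Sum>i\<in>I. g h i *\<^sub>R v i)"
      unfolding g_def scaleR_sum_right scaleR_sum_left scaleR_scaleR by (rule sum.swap)
    finally show ?thesis .
  qed
  moreover have "\<bar>g h i\<bar> \<le> C * norm h" if "i \<in> I" for h i
  proof -
    have "\<bar>g h i\<bar> \<le> (\<Sum>b\<in>Basis. \<bar>(h \<bullet> b) * \<beta> b i\<bar>)" unfolding g_def by (rule sum_abs)
    also have "\<dots> \<le> (\<Sum>b\<in>Basis. norm h * \<bar>\<beta> b i\<bar>)"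
      unfolding abs_mult by (intro sum_mono mult_right_mono Basis_le_norm) auto
    also have "\<dots> = (\<Sum>b\<in>Basis. \<bar>\<beta> b i\<bar>) * norm h" by (simp add: mult.commute flip: sum_distrib_left)
    also have "\<dots> \<le> C * norm h"
      unfolding C_def using I(1) that
      by (intro mult_right_mono member_le_sum[of i I "\<lambda>i. \<Sum>b\<in>Basis. \<bar>\<beta> b i\<bar>"]) (auto intro: sum_nonneg)
    finally show ?thesis .
  qed
  ultimately show ?thesis by (rule that)
qed

lemma span_differences_if_full_aff_dim:
  fixes p :: "nat \<Rightarrow> 'a::euclidean_space"
  assumes "aff_dim (p ` {..n}) = int DIM('a)"
  shows "span ((\<lambda>i. p i - p 0) ` {1..n}) = UNIV"
proof -
  have "p 0 \<in> affine hull (p ` {..n})" by (intro hull_inc) simp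
  then have "dim ((\<lambda>x. x - p 0) ` p ` {..n}) = DIM('a)"
    using aff_dim_eq_dim_subtract[of "p 0" "p ` {..n}"] assms by simp
  then have "span ((\<lambda>x. x - p 0) ` p ` {..n}) = UNIV" by (simp only: dim_eq_full)
  moreover have "{..n} = insert 0 {1..n}" by auto
  then have "(\<lambda>x. x - p 0) ` p ` {..n} = insert 0 ((\<lambda>i. p i - p 0) ` {1..n})"
    by (simp add: image_image)
  ultimately show ?thesis by (simp add: span_insert_0)
qed

text \<open>Exponents congruent to \<open>i\<close> modulo \<open>n + 1\<close> choose between the digits 0 and \<open>i\<close>; the multiples of
  \<open>n + 1\<close> are left to the greedy choice.\<close>

definition fine_exponents :: "nat \<Rightarrow> nat \<Rightarrow> nat set" where
  "fine_exponents n K = {j. j < (n + 1) * K \<and> j mod (n + 1) \<noteq> 0}"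

lemma finite_fine_exponents [simp]: "finite (fine_exponents n K)"
  unfolding fine_exponents_def by simp

lemma sum_fine_exponents:
  fixes f :: "nat \<Rightarrow> 'a::comm_monoid_add"
  shows "(\<Sum>j\<in>fine_exponents n K. f j) = (\<Sum>i=1..n. \<Sum>k<K. f ((n + 1) * k + i))"
proof -
  define N where "N = n + 1"
  define g where "g j = (if j mod N \<noteq> 0 then f j else 0)" for j
  have "(\<Sum>j\<in>fine_exponents n K. f j) = (\<Sum>j<K * N. g j)"
    unfolding fine_exponents_def g_def N_def
    by (subst sum.inter_filter[symmetric]) (auto simp: mult.commute)
  also have "\<dots> = (\<Sum>k<K. \<Sum>j\<in>{k * N..<k * N + N}. g j)" by (rule sum.nat_group[symmetric])
  also have "\<dots> = (\<Sum>k<K. \<Sum>i=1..n. f (N * k + i))"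
  proof (rule sum.cong[OF refl])
    fix k
    have "(\<Sum>j\<in>{k * N..<k * N + N}. g j) = (\<Sum>i\<in>{0..<N}. g (k * N + i))"
      using sum.shift_bounds_nat_ivl[of g 0 "k * N" N] by (simp add: add.commute)
    also have "\<dots> = (\<Sum>i\<in>{0..<N}. if i \<noteq> 0 then f (N * k + i) else 0)"
      by (intro sum.cong) (auto simp: g_def mult.commute)
    also have "\<dots> = (\<Sum>i=1..n. f (N * k + i))"
      by (intro sum.mono_neutral_cong_right) (auto simp: N_def)
    finally show "(\<Sum>j\<in>{k * N..<k * N + N}. g j) = (\<Sum>i=1..n. f (N * k + i))" .
  qed
  also have "\<dots> = (\<Sum>i=1..n. \<Sum>k<K. f (N * k + i))" by (rule sum.swap)
  finally show ?thesis unfolding N_def .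
qed

definition fine_digit :: "nat \<Rightarrow> (nat \<Rightarrow> nat set) \<Rightarrow> nat \<Rightarrow> nat" where
  "fine_digit n E j = (if j div (n + 1) \<in> E (j mod (n + 1)) then j mod (n + 1) else 0)"

lemma fine_digit_le: "fine_digit n E j \<le> n"
  using mod_less_divisor[of "n + 1" j] by (simp add: fine_digit_def)

lemma sum_fine_digits:
  fixes p :: "nat \<Rightarrow> 'a::real_vector"
  assumes "\<And>i. E i \<subseteq> {..<K}"
  shows "(\<Sum>j\<in>fine_exponents n K. q ^ j *\<^sub>R p (fine_digit n E j))
    = (\<Sum>j\<in>fine_exponents n K. q ^ j *\<^sub>R p 0)
      + (\<Sum>i=1..n. (q ^ i * power_sum (q ^ (n + 1)) (E i)) *\<^sub>R (p i - p 0))"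
proof -
  have "(\<Sum>j\<in>fine_exponents n K. q ^ j *\<^sub>R p (fine_digit n E j))
      = (\<Sum>j\<in>fine_exponents n K. q ^ j *\<^sub>R p 0)
        + (\<Sum>j\<in>fine_exponents n K. q ^ j *\<^sub>R (p (fine_digit n E j) - p 0))"
    by (simp add: scaleR_diff_right flip: sum.distrib)
  also have "(\<Sum>j\<in>fine_exponents n K. q ^ j *\<^sub>R (p (fine_digit n E j) - p 0))
      = (\<Sum>i=1..n. (q ^ i * power_sum (q ^ (n + 1)) (E i)) *\<^sub>R (p i - p 0))"
    unfolding sum_fine_exponents
  proof (rule sum.cong[OF refl])
    fix i assume i: "i \<in> {1..n}"
    then have digit: "fine_digit n E ((n + 1) * k + i) = (if k \<in> E i then i else 0)" for k
      by (simp add: fine_digit_def del: mult_Suc)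
    have "(\<Sum>k<K. q ^ ((n + 1) * k + i) *\<^sub>R (p (fine_digit n E ((n + 1) * k + i)) - p 0))
        = (\<Sum>k<K. if k \<in> E i then q ^ ((n + 1) * k + i) *\<^sub>R (p i - p 0) else 0)"
      unfolding digit by (intro sum.cong) auto
    also have "\<dots> = (\<Sum>k\<in>E i. q ^ ((n + 1) * k + i) *\<^sub>R (p i - p 0))"
      using assms[of i] by (simp add: sum.inter_restrict[symmetric] Int_absorb1)
    also have "q ^ ((n + 1) * k + i) = q ^ i * (q ^ (n + 1)) ^ k" for k
      by (metis power_add power_mult mult.commute)
    then have "(\<Sum>k\<in>E i. q ^ ((n + 1) * k + i) *\<^sub>R (p i - p 0))
        = (q ^ i * power_sum (q ^ (n + 1)) (E i)) *\<^sub>R (p i - p 0)"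
      by (simp only: power_sum_def sum_distrib_left scaleR_sum_left)
    finally show "(\<Sum>k<K. q ^ ((n + 1) * k + i) *\<^sub>R (p (fine_digit n E ((n + 1) * k + i)) - p 0))
        = (q ^ i * power_sum (q ^ (n + 1)) (E i)) *\<^sub>R (p i - p 0)" .
  qed
  finally show ?thesis .
qed

lemma fine_digits_net:
  fixes p :: "nat \<Rightarrow> 'a::real_normed_vector" and q :: real
  assumes q: "1 < q" "q ^ (n + 1) < 1 + 1/100" and "0 < e"
  obtains K z where "\<And>t. (\<And>i. i \<in> {1..n} \<Longrightarrow> t i \<in> {0..R}) \<Longrightarrow> \<exists>d. (\<forall>j. d j \<le> n) \<and>
    norm (z + (\<Sum>i=1..n. (q ^ i * t i) *\<^sub>R (p i - p 0)) - (\<Sum>j\<in>fine_exponents n K. q ^ j *\<^sub>R p (d j))) < e"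
proof -
  define V \<epsilon> where "V = (\<Sum>i=1..n. q ^ i * norm (p i - p 0))" and "\<epsilon> = e / (V + 1)"
  have "0 \<le> V" unfolding V_def using q(1) by (intro sum_nonneg) auto
  then have \<epsilon>: "0 < \<epsilon>" "\<epsilon> * V < e" using \<open>0 < e\<close> by (simp_all add: \<epsilon>_def field_simps)
  have "1 < q ^ (n + 1)" using q(1) by (intro one_less_power) auto
  then obtain K \<tau> where net: "\<And>t. t \<in> {0..R} \<Longrightarrow> \<exists>E\<subseteq>{..<K}. \<bar>\<tau> + t - power_sum (q ^ (n + 1)) E\<bar> \<le> \<epsilon>"
    using power_net_exists[OF _ q(2) \<epsilon>(1)] unfolding power_net_def by metis
  define z where "z = (\<Sum>j\<in>fine_exponents n K. q ^ j *\<^sub>R p 0) + (\<Sum>i=1..n. (q ^ i * \<tau>) *\<^sub>R (p i - p 0))"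
  have "\<exists>d. (\<forall>j. d j \<le> n) \<and> norm (z + (\<Sum>i=1..n. (q ^ i * t i) *\<^sub>R (p i - p 0))
      - (\<Sum>j\<in>fine_exponents n K. q ^ j *\<^sub>R p (d j))) < e" if t: "\<And>i. i \<in> {1..n} \<Longrightarrow> t i \<in> {0..R}" for t
  proof -
    have "\<forall>i. \<exists>E\<subseteq>{..<K}. i \<in> {1..n} \<longrightarrow> \<bar>\<tau> + t i - power_sum (q ^ (n + 1)) E\<bar> \<le> \<epsilon>"
      using net t by (metis empty_subsetI)
    then obtain E where E: "\<And>i. E i \<subseteq> {..<K}"
        "\<And>i. i \<in> {1..n} \<Longrightarrow> \<bar>\<tau> + t i - power_sum (q ^ (n + 1)) (E i)\<bar> \<le> \<epsilon>"
      by metis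
    define r where "r i = \<tau> + t i - power_sum (q ^ (n + 1)) (E i)" for i
    have "z + (\<Sum>i=1..n. (q ^ i * t i) *\<^sub>R (p i - p 0))
        - (\<Sum>j\<in>fine_exponents n K. q ^ j *\<^sub>R p (fine_digit n E j)) = (\<Sum>i=1..n. (q ^ i * r i) *\<^sub>R (p i - p 0))"
      unfolding sum_fine_digits[OF E(1), where p = p] z_def r_def
      by (simp add: ring_distribs scaleR_add_left scaleR_diff_left sum.distrib sum_subtractf)
    also have "norm \<dots> \<le> (\<Sum>i=1..n. \<epsilon> * (q ^ i * norm (p i - p 0)))"
    proof (rule sum_norm_le)
      fix i assume "i \<in> {1..n}"
      then have "\<bar>r i\<bar> * (q ^ i * norm (p i - p 0)) \<le> \<epsilon> * (q ^ i * norm (p i - p 0))"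
        unfolding r_def using E(2) q(1) by (intro mult_right_mono) auto
      then show "norm ((q ^ i * r i) *\<^sub>R (p i - p 0)) \<le> \<epsilon> * (q ^ i * norm (p i - p 0))"
        using q(1) by (simp add: abs_mult mult_ac)
    qed
    also have "\<dots> < e" using \<epsilon>(2) by (simp add: V_def sum_distrib_left)
    finally show ?thesis using fine_digit_le by blast
  qed
  then show ?thesis by (rule that)
qed

lemma fine_digits_dense:
  fixes p :: "nat \<Rightarrow> 'a::euclidean_space" and q :: real
  assumes full: "aff_dim (p ` {..n}) = int DIM('a)" and q: "1 < q" "q ^ (n + 1) < 1 + 1/100" and "0 < e"
  obtains K z where "\<And>h. norm h \<le> R \<Longrightarrow> \<exists>d. (\<forall>j. d j \<le> n) \<and>
    norm (z + h - (\<Sum>j\<in>fine_exponents n K. q ^ j *\<^sub>R p (d j))) < e"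
proof -
  obtain g C where g: "\<And>h. h = (\<Sum>i=1..n. g h i *\<^sub>R (p i - p 0))"
      "\<And>h i. i \<in> {1..n} \<Longrightarrow> \<bar>g h i\<bar> \<le> C * norm h"
    using spanning_family_coordinates[OF _ span_differences_if_full_aff_dim[OF full]]
    by (metis finite_atLeastAtMost)
  define R' where "R' = max 0 C * R"
  obtain K z where net: "\<And>t. (\<And>i. i \<in> {1..n} \<Longrightarrow> t i \<in> {0..2 * R'}) \<Longrightarrow> \<exists>d. (\<forall>j. d j \<le> n) \<and>
      norm (z + (\<Sum>i=1..n. (q ^ i * t i) *\<^sub>R (p i - p 0)) - (\<Sum>j\<in>fine_exponents n K. q ^ j *\<^sub>R p (d j))) < e"
    by (rule fine_digits_net[OF q \<open>0 < e\<close>]) (erule that)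
  define z' where "z' = z + (\<Sum>i=1..n. (q ^ i * R') *\<^sub>R (p i - p 0))"
  have "\<exists>d. (\<forall>j. d j \<le> n) \<and> norm (z' + h - (\<Sum>j\<in>fine_exponents n K. q ^ j *\<^sub>R p (d j))) < e"
    if h: "norm h \<le> R" for h
  proof -
    define t where "t i = R' + g h i / q ^ i" for i
    have "t i \<in> {0..2 * R'}" if "i \<in> {1..n}" for i
    proof -
      have "\<bar>g h i / q ^ i\<bar> \<le> \<bar>g h i\<bar>"
        using q(1) by (simp add: abs_divide divide_le_eq mult_le_cancel_left1 one_le_power)
      also have "\<dots> \<le> max 0 C * norm h"
        by (rule order_trans[OF g(2)[OF that]]) (intro mult_right_mono, auto)
      also have "\<dots> \<le> R'" unfolding R'_def using h by (intro mult_left_mono) auto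
      finally have "- R' \<le> g h i / q ^ i" "g h i / q ^ i \<le> R'" by linarith+
      then show ?thesis by (simp add: t_def)
    qed
    moreover have "q ^ i * t i = q ^ i * R' + g h i" for i using q(1) by (simp add: t_def distrib_left)
    then have "z + (\<Sum>i=1..n. (q ^ i * t i) *\<^sub>R (p i - p 0)) = z' + h"
      using g(1)[of h] by (simp add: z'_def scaleR_add_left sum.distrib)
    ultimately show ?thesis using net[of t] by simp
  qed
  then show ?thesis by (rule that)
qed

section \<open>Density of expanding orbits\<close>

definition expand :: "real \<Rightarrow> (nat \<Rightarrow> 'a::real_vector) \<Rightarrow> (nat \<Rightarrow> nat) \<Rightarrow> nat \<Rightarrow> 'a \<Rightarrow> 'a" where
  "expand q p d m x = q ^ m *\<^sub>R x - (q - 1) *\<^sub>R (\<Sum>j<m. q ^ j *\<^sub>R p (d j))"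

lemma eventually_rescaled_in_open:
  fixes x c :: "'a::real_normed_vector"
  assumes "1 < q" "open U" "x \<in> U"
  shows "\<forall>\<^sub>F m in sequentially. s < q ^ m \<and> (1 / (q ^ m - s)) *\<^sub>R (q ^ m *\<^sub>R x - c) \<in> U"
proof -
  have top: "filterlim (\<lambda>m. q ^ m) at_top sequentially"
    using assms(1)
    by (intro filterlim_at_infinity_imp_filterlim_at_top filterlim_realpow_sequentially_gt1) auto
  then have "filterlim (\<lambda>m. - s + q ^ m) at_top sequentially"
    by (rule filterlim_tendsto_add_at_top[OF tendsto_const])
  then have "(\<lambda>m. x + (1 / (q ^ m - s)) *\<^sub>R (s *\<^sub>R x - c)) \<longlonglongrightarrow> x + 0 *\<^sub>R (s *\<^sub>R x - c)"
    by (intro tendsto_intros tendsto_divide_0[OF tendsto_const] filterlim_at_top_imp_at_infinity) simp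
  then have "\<forall>\<^sub>F m in sequentially. x + (1 / (q ^ m - s)) *\<^sub>R (s *\<^sub>R x - c) \<in> U"
    using assms(2,3) by (intro topological_tendstoD) auto
  moreover have "\<forall>\<^sub>F m in sequentially. s < q ^ m"
    using top by (simp add: filterlim_at_top_dense)
  ultimately show ?thesis
  proof eventually_elim
    case (elim m)
    have "q ^ m *\<^sub>R x - c = (q ^ m - s) *\<^sub>R x + (s *\<^sub>R x - c)" by (simp add: algebra_simps)
    then have "(1 / (q ^ m - s)) *\<^sub>R (q ^ m *\<^sub>R x - c) = x + (1 / (q ^ m - s)) *\<^sub>R (s *\<^sub>R x - c)"
      using elim(2) by (simp only: scaleR_add_right) simp
    then show ?case using elim by (simp only:)
  qed
qed

lemma expand_diff_split:
  fixes x :: "'a::real_vector" and q :: real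
  assumes F: "F \<subseteq> {..<m}" and "1 < q"
    and x': "(q ^ m - (1 + (q - 1) * (\<Sum>j\<in>F. q ^ j))) *\<^sub>R x' = q ^ m *\<^sub>R x - (y + (q - 1) *\<^sub>R z)"
  shows "expand q p (\<lambda>j. if j \<in> F then d j else c j) m x - y
    = (q - 1) *\<^sub>R (z + ((\<Sum>j\<in>{..<m} - F. q ^ j) *\<^sub>R x' - (\<Sum>j\<in>{..<m} - F. q ^ j *\<^sub>R p (c j)))
        - (\<Sum>j\<in>F. q ^ j *\<^sub>R p (d j)))"
proof -
  have split: "(\<Sum>j<m. f j) = (\<Sum>j\<in>{..<m} - F. f j) + (\<Sum>j\<in>F. f j)" for f :: "nat \<Rightarrow> 'b::comm_monoid_add"
    using sum.subset_diff[OF F finite_lessThan, of f] by simp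
  have "(q - 1) * (\<Sum>j<m. q ^ j) = q ^ m - 1" using \<open>1 < q\<close> by (simp add: geometric_sum)
  then have "(q - 1) * (\<Sum>j\<in>{..<m} - F. q ^ j) = q ^ m - (1 + (q - 1) * (\<Sum>j\<in>F. q ^ j))"
    by (simp add: split algebra_simps)
  then have scaled: "(q - 1) *\<^sub>R ((\<Sum>j\<in>{..<m} - F. q ^ j) *\<^sub>R x') = q ^ m *\<^sub>R x - y - (q - 1) *\<^sub>R z"
    using x' by simp
  have "(\<Sum>j<m. q ^ j *\<^sub>R p (if j \<in> F then d j else c j))
      = (\<Sum>j\<in>{..<m} - F. q ^ j *\<^sub>R p (c j)) + (\<Sum>j\<in>F. q ^ j *\<^sub>R p (d j))"
    unfolding split by (intro arg_cong2[where f="(+)"] sum.cong) auto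
  then show ?thesis
    unfolding scaleR_diff_right scaleR_add_right scaled expand_def by (simp add: scaleR_add_right)
qed

text \<open>The fine digits correct the error of the coarse digits, which are chosen greedily and whose error
  bound does not depend on how many exponents are set aside for the fine digits.\<close>

lemma expand_dense:
  fixes p :: "nat \<Rightarrow> 'a::euclidean_space" and q :: real
  assumes full: "aff_dim (p ` {..n}) = int DIM('a)"
    and q: "1 < q" "q ^ (n + 1) < 1 + 1/100" "real (n + 1) * (q ^ (n + 1) - 1) \<le> 1/2"
    and x: "x \<in> interior (convex hull (p ` {..n}))" and "0 < e"
  obtains m d where "\<And>j. d j \<le> n" "dist (expand q p d m x) y < e"
proof -
  obtain k\<^sub>0 R where coarse: "\<And>F m x. (\<And>l. (n + 1) * l \<notin> F) \<Longrightarrow> k\<^sub>0 \<le> m \<Longrightarrow> x \<in> convex hull (p ` {..n}) \<Longrightarrow>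
      \<exists>c. (\<forall>j. c j \<le> n) \<and> norm ((\<Sum>j\<in>{..<m} - F. q ^ j) *\<^sub>R x - (\<Sum>j\<in>{..<m} - F. q ^ j *\<^sub>R p (c j))) \<le> R"
    by (rule coarse_digits[OF q(1,3)]) (erule that)
  have "0 < e / (q - 1)" using \<open>0 < e\<close> q(1) by simp
  then obtain K z where fine: "\<And>h. norm h \<le> R \<Longrightarrow> \<exists>d. (\<forall>j. d j \<le> n) \<and>
      norm (z + h - (\<Sum>j\<in>fine_exponents n K. q ^ j *\<^sub>R p (d j))) < e / (q - 1)"
    by (rule fine_digits_dense[OF full q(1,2)]) (erule that)
  define F where "F = fine_exponents n K"
  define s where "s = 1 + (q - 1) * (\<Sum>j\<in>F. q ^ j)"
  define x' where "x' m = (1 / (q ^ m - s)) *\<^sub>R (q ^ m *\<^sub>R x - (y + (q - 1) *\<^sub>R z))" for m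
  have "\<forall>\<^sub>F m in sequentially. (s < q ^ m \<and> x' m \<in> interior (convex hull (p ` {..n})))
      \<and> (n + 1) * K \<le> m \<and> k\<^sub>0 \<le> m"
    unfolding x'_def using q(1) x
    by (intro eventually_conj eventually_rescaled_in_open eventually_ge_at_top) auto
  then obtain m where m: "s < q ^ m" "x' m \<in> interior (convex hull (p ` {..n}))" "(n + 1) * K \<le> m" "k\<^sub>0 \<le> m"
    using eventually_happens'[OF sequentially_bot] by blast
  have "x' m \<in> convex hull (p ` {..n})" using m(2) interior_subset by blast
  moreover have "(n + 1) * l \<notin> F" for l
    by (simp only: F_def fine_exponents_def mem_Collect_eq mod_mult_self1_is_0) simp
  ultimately obtain c where c: "\<And>j. c j \<le> n"
      "norm ((\<Sum>j\<in>{..<m} - F. q ^ j) *\<^sub>R x' m - (\<Sum>j\<in>{..<m} - F. q ^ j *\<^sub>R p (c j))) \<le> R"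
    using coarse[of F m "x' m"] m(4) by blast
  then obtain d where d: "\<And>j. d j \<le> n"
    "norm (z + ((\<Sum>j\<in>{..<m} - F. q ^ j) *\<^sub>R x' m - (\<Sum>j\<in>{..<m} - F. q ^ j *\<^sub>R p (c j)))
      - (\<Sum>j\<in>F. q ^ j *\<^sub>R p (d j))) < e / (q - 1)"
    using fine unfolding F_def by blast
  have "F \<subseteq> {..<m}" using m(3) by (auto simp: F_def fine_exponents_def)
  moreover have "(q ^ m - s) *\<^sub>R x' m = q ^ m *\<^sub>R x - (y + (q - 1) *\<^sub>R z)" using m(1) by (simp add: x'_def)
  ultimately have "dist (expand q p (\<lambda>j. if j \<in> F then d j else c j) m x) y < e"
    using d(2) q(1) unfolding s_def
    by (simp add: dist_norm expand_diff_split pos_less_divide_eq mult.commute)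
  then show ?thesis using c(1) d(1) by (intro that[of "\<lambda>j. if j \<in> F then d j else c j"]) auto
qed

section \<open>The attractor\<close>

abbreviation apply_word :: "real \<Rightarrow> (nat \<Rightarrow> 'a::euclidean_space) \<Rightarrow> nat list \<Rightarrow> 'a \<Rightarrow> 'a" where
  "apply_word lam p v \<equiv> foldr (hmap lam p) v"

lemma word_map_eq_apply_word: "word_map lam p a j z = apply_word lam p (map a [0..<j]) z"
  by (induction j arbitrary: z) simp_all

lemma apply_word_diff: "apply_word lam p v x - apply_word lam p v y = lam ^ length v *\<^sub>R (x - y)"
proof (induction v)
  case (Cons i v)
  have "apply_word lam p (i # v) x - apply_word lam p (i # v) y
      = lam *\<^sub>R (apply_word lam p v x - apply_word lam p v y)"
    by (simp add: hmap_def algebra_simps)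
  then show ?case unfolding Cons by simp
qed simp

lemma apply_word_mem_convex_hull:
  assumes "0 \<le> lam" "lam \<le> 1" "set v \<subseteq> {..n}" "z \<in> convex hull (p ` {..n})"
  shows "apply_word lam p v z \<in> convex hull (p ` {..n})"
  using assms(3)
proof (induction v)
  case (Cons i v)
  then show ?case
    using assms(1,2) unfolding foldr_Cons comp_apply hmap_def
    by (intro convexD[OF convex_convex_hull]) (auto intro: hull_inc)
qed (use assms(4) in simp)

lemma infdist_hmap_le:
  assumes "0 \<le> lam" "closed Y" "Y \<noteq> {}" "hmap lam p i ` Y \<subseteq> Y"
  shows "infdist (hmap lam p i z) Y \<le> lam * infdist z Y"
proof -
  obtain y where y: "y \<in> Y" "infdist z Y = dist z y" using infdist_attains_inf[OF assms(2,3)] by metis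
  have "infdist (hmap lam p i z) Y \<le> dist (hmap lam p i z) (hmap lam p i y)"
    using assms(4) y(1) by (intro infdist_le) auto
  also have "\<dots> = lam * dist z y"
    using assms(1) apply_word_diff[of lam p "[i]" z y] by (simp add: dist_norm)
  finally show ?thesis by (simp add: y(2))
qed

text \<open>At a point of \<open>X\<close> farthest from \<open>Y\<close>, the contraction forces the distance to be 0.\<close>

lemma compact_subset_if_invariant:
  fixes p :: "nat \<Rightarrow> 'a::euclidean_space"
  assumes lam: "0 \<le> lam" "lam < 1"
    and X: "compact X" "X \<subseteq> (\<Union>i\<in>{..n}. hmap lam p i ` X)"
    and Y: "compact Y" "Y \<noteq> {}" "(\<Union>i\<in>{..n}. hmap lam p i ` Y) \<subseteq> Y"
  shows "X \<subseteq> Y"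
proof (cases "X = {}")
  case False
  have "\<exists>x\<in>X. \<forall>z\<in>X. infdist z Y \<le> infdist x Y"
    by (intro continuous_attains_sup X(1) False continuous_intros)
  then obtain x where x: "x \<in> X" "\<And>z. z \<in> X \<Longrightarrow> infdist z Y \<le> infdist x Y" by blast
  obtain i z where z: "i \<le> n" "z \<in> X" "x = hmap lam p i z" using X(2) x(1) by auto
  have "infdist x Y \<le> lam * infdist z Y"
    unfolding z(3) using lam Y z(1) by (intro infdist_hmap_le compact_imp_closed) auto
  also have "\<dots> \<le> lam * infdist x Y" using lam(1) x(2)[OF z(2)] by (intro mult_left_mono)
  finally have "infdist x Y \<le> 0"
    using lam(2) mult_less_cancel_right2[of lam "infdist x Y"] infdist_nonneg[of x Y] by linarith
  then have "infdist z Y = 0" if "z \<in> X" for z using x(2)[OF that] infdist_nonneg[of z Y] by linarith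
  then show ?thesis using in_closed_iff_infdist_zero[OF compact_imp_closed[OF Y(1)] Y(2)] by blast
qed simp

lemma attractor_eqI:
  fixes p :: "nat \<Rightarrow> 'a::euclidean_space"
  assumes lam: "0 \<le> lam" "lam < 1" and X: "X \<noteq> {}" "compact X" "X = (\<Union>i\<in>{..n}. hmap lam p i ` X)"
  shows "attractor lam p n = X"
  unfolding attractor_def
proof (rule the_equality)
  fix Y assume "Y \<noteq> {} \<and> compact Y \<and> Y = (\<Union>i\<in>{..n}. hmap lam p i ` Y)"
  then have Y: "Y \<noteq> {}" "compact Y" and invariant: "Y = (\<Union>i\<in>{..n}. hmap lam p i ` Y)" by metis+
  show "Y = X"
  proof
    show "Y \<subseteq> X"
      using compact_subset_if_invariant[OF lam Y(2) _ X(2,1)] equalityD1[OF invariant] equalityD2[OF X(3)] by blast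
    show "X \<subseteq> Y"
      using compact_subset_if_invariant[OF lam X(2) _ Y(2,1)] equalityD1[OF X(3)] equalityD2[OF invariant] by blast
  qed
qed (intro conjI X)

lemma attractor_eq_convex_hull:
  fixes p :: "nat \<Rightarrow> 'a::euclidean_space"
  assumes lam: "0 \<le> lam" "lam < 1" "real (n + 1) * (1 - lam) \<le> 1"
  shows "attractor lam p n = convex hull (p ` {..n})"
proof (rule attractor_eqI[OF lam(1,2)])
  let ?H = "convex hull (p ` {..n})"
  have "real (card (p ` {..n})) * (1 - lam) \<le> real (n + 1) * (1 - lam)"
    using card_image_le[of "{..n}" p] lam(2) by (intro mult_right_mono) auto
  then have card: "real (card (p ` {..n})) * (1 - lam) \<le> 1" using lam(3) by linarith
  have "x \<in> (\<Union>i\<in>{..n}. hmap lam p i ` ?H)" if x: "x \<in> ?H" for x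
  proof -
    obtain y x' where "y \<in> p ` {..n}" "x' \<in> ?H" "x = (1 - lam) *\<^sub>R y + (1 - (1 - lam)) *\<^sub>R x'"
      using convex_hull_finite_split[OF _ x _ card] lam(2) by auto
    then show ?thesis by (auto simp: hmap_def add.commute)
  qed
  moreover have "hmap lam p i z \<in> ?H" if "i \<le> n" "z \<in> ?H" for i z
    using apply_word_mem_convex_hull[of lam "[i]" n z p] that lam by simp
  ultimately show "?H = (\<Union>i\<in>{..n}. hmap lam p i ` ?H)" by blast
qed (simp_all add: finite_imp_compact_convex_hull)

section \<open>Codings\<close>

lemma word_map_0_eq_sum: "word_map lam p a j 0 = (\<Sum>k<j. (lam ^ k * (1 - lam)) *\<^sub>R p (a k))"
proof (induction j)
  case (Suc j)
  have "word_map lam p a (Suc j) 0 - word_map lam p a j 0 = lam ^ j *\<^sub>R hmap lam p (a j) 0"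
    using apply_word_diff[of lam p "map a [0..<j]" "hmap lam p (a j) 0" 0]
    by (simp add: word_map_eq_apply_word)
  then show ?case using Suc by (simp add: hmap_def algebra_simps del: word_map.simps)
qed simp

lemma coding_sums:
  fixes p :: "nat \<Rightarrow> 'a::euclidean_space"
  assumes lam: "0 \<le> lam" "lam < 1" and a: "\<And>k. a k \<le> n"
  shows "(\<lambda>k. (lam ^ k * (1 - lam)) *\<^sub>R p (a k)) sums coding lam p a"
proof -
  obtain B where B: "\<And>i. i \<le> n \<Longrightarrow> norm (p i) \<le> B"
    using finite_imp_bounded[of "p ` {..n}"] by (auto simp: bounded_iff)
  have "summable (\<lambda>k. (lam ^ k * (1 - lam)) *\<^sub>R p (a k))"
  proof (rule summable_comparison_test')
    show "summable (\<lambda>k. lam ^ k * ((1 - lam) * B))"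
      using lam by (intro summable_mult2 summable_geometric) auto
    show "norm ((lam ^ k * (1 - lam)) *\<^sub>R p (a k)) \<le> lam ^ k * ((1 - lam) * B)" for k
      using lam B[OF a[of k]] by (simp add: abs_mult mult.assoc mult_left_mono)
  qed
  then have "convergent (\<lambda>j. word_map lam p a j 0)"
    by (simp only: word_map_0_eq_sum summable_iff_convergent)
  then show ?thesis
    unfolding sums_def word_map_0_eq_sum[symmetric] coding_def by (simp only: convergent_LIMSEQ_iff)
qed

lemma coding_eqI:
  fixes p :: "nat \<Rightarrow> 'a::euclidean_space"
  assumes lam: "0 \<le> lam" "lam < 1" and "bounded H" and x: "\<And>j. \<exists>z\<in>H. x = word_map lam p a j z"
  shows "coding lam p a = x"
proof -
  obtain B where B: "\<And>z. z \<in> H \<Longrightarrow> norm z \<le> B" using \<open>bounded H\<close> by (auto simp: bounded_iff)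
  have "norm (word_map lam p a j 0 - x) \<le> lam ^ j * B" for j
  proof -
    obtain z where z: "z \<in> H" "x = word_map lam p a j z" using x by blast
    then have "word_map lam p a j 0 - x = lam ^ j *\<^sub>R (0 - z)"
      using apply_word_diff[of lam p "map a [0..<j]" 0 z] by (simp add: word_map_eq_apply_word)
    then show ?thesis using B[OF z(1)] lam(1) by (simp add: mult_left_mono)
  qed
  then have "\<forall>\<^sub>F j in sequentially. norm (word_map lam p a j 0 - x) \<le> lam ^ j * B" by simp
  moreover have "(\<lambda>j. lam ^ j * B) \<longlonglongrightarrow> 0"
    using lam by (intro tendsto_mult_left_zero LIMSEQ_realpow_zero) auto
  ultimately have "(\<lambda>j. word_map lam p a j 0 - x) \<longlonglongrightarrow> 0" by (rule Lim_null_comparison)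
  then show ?thesis unfolding coding_def by (intro limI) (simp add: LIM_zero_iff)
qed

lemma universal_digit_occurs: "universal n a \<Longrightarrow> i \<le> n \<Longrightarrow> \<exists>k. a k = i"
  unfolding universal_def by (drule spec[of _ "[i]"]) auto

text \<open>On a supporting hyperplane at a boundary point \<open>x\<close>, every digit of a coding of \<open>x\<close> is extremal;
  a universal coding uses all digits, so the hull would lie inside the hyperplane.\<close>

lemma universal_coding_in_interior:
  fixes p :: "nat \<Rightarrow> 'a::euclidean_space"
  assumes full: "aff_dim (p ` {..n}) = int DIM('a)" and lam: "0 < lam" "lam < 1"
    and a: "\<And>k. a k \<le> n" "universal n a" and x: "coding lam p a \<in> convex hull (p ` {..n})"
  shows "coding lam p a \<in> interior (convex hull (p ` {..n}))"
proof (rule ccontr)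
  let ?H = "convex hull (p ` {..n})" and ?x = "coding lam p a"
  assume "?x \<notin> interior ?H"
  moreover have "rel_interior ?H = interior ?H"
    using full by (intro rel_interior_interior) (simp add: aff_dim_eq_full)
  ultimately obtain f where f: "\<And>y. y \<in> ?H \<Longrightarrow> f \<bullet> ?x \<le> f \<bullet> y" "\<And>y. y \<in> rel_interior ?H \<Longrightarrow> f \<bullet> ?x < f \<bullet> y"
    using supporting_hyperplane_rel_boundary[OF convex_convex_hull x] by metis
  define g where "g k = lam ^ k * (1 - lam) * (f \<bullet> p (a k)) - lam ^ k * (1 - lam) * (f \<bullet> ?x)" for k
  have g: "g k = lam ^ k * (1 - lam) * (f \<bullet> p (a k) - f \<bullet> ?x)" for k
    unfolding g_def by (rule right_diff_distrib[symmetric])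
  have "(\<lambda>k. lam ^ k * (1 - lam) * (f \<bullet> p (a k))) sums (f \<bullet> ?x)"
    using bounded_linear.sums[OF bounded_linear_inner_right coding_sums[of lam a n p]] lam a(1) by simp
  moreover have "(\<lambda>k. lam ^ k * (1 - lam)) sums 1"
    using sums_mult2[OF geometric_sums[of lam], of "1 - lam"] lam by simp
  ultimately have "g sums (f \<bullet> ?x - 1 * (f \<bullet> ?x))"
    unfolding g_def by (intro sums_diff sums_mult2)
  then have "g sums 0" by simp
  moreover have "0 \<le> g k" for k
    unfolding g using lam a(1) by (intro mult_nonneg_nonneg) (auto intro!: f(1) hull_inc)
  ultimately have "g k = 0" for k
    using suminf_eq_zero_iff[of g] by (simp add: sums_iff)
  then have "f \<bullet> p (a k) = f \<bullet> ?x" for k using lam by (simp add: g)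
  then have "f \<bullet> p i = f \<bullet> ?x" if "i \<le> n" for i using universal_digit_occurs[OF a(2) that] by metis
  then have "?H \<subseteq> {z. f \<bullet> z = f \<bullet> ?x}" by (intro hull_minimal convex_hyperplane) auto
  moreover have "rel_interior ?H \<noteq> {}" by (simp add: rel_interior_eq_empty)
  then obtain y where "y \<in> rel_interior ?H" by blast
  ultimately show False using f(2) rel_interior_subset by fastforce
qed

section \<open>Universal sequences\<close>

lemma prefix_chain_limit:
  assumes chain: "\<And>k. prefix (V k) (V (Suc k))" and length: "\<And>k. k \<le> length (V k)"
  obtains a where "\<And>k. V k = map a [0..<length (V k)]"
proof -
  have nth: "V k ! i = V l ! i" if "k \<le> l" "i < length (V k)" for i k l
    using prefix_order.lift_Suc_mono_le[of V, OF chain that(1)] that(2)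
    by (auto simp: prefix_def nth_append)
  have "V k ! i = V (Suc i) ! i" if "i < length (V k)" for i k
    using nth[of k "max k (Suc i)" i] nth[of "Suc i" "max k (Suc i)" i] that length[of "Suc i"] by simp
  then show ?thesis by (intro that[of "\<lambda>i. V (Suc i) ! i"] nth_equalityI) auto
qed

lemma universalI:
  assumes "\<And>w. set w \<subseteq> {..n} \<Longrightarrow> \<exists>k u v. map a [0..<k] = u @ w @ v"
  shows "universal n a"
  unfolding universal_def
proof (intro allI impI)
  fix w :: "nat list" assume "set w \<subseteq> {..n}"
  then obtain k u v where uwv: "map a [0..<k] = u @ w @ v" using assms by blast
  have "a (length u + i) = w ! i" if "i < length w" for i
  proof -
    have "length u + i < k" using arg_cong[OF uwv, of length] that by simp
    then have "a (length u + i) = (u @ w @ v) ! (length u + i)"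
      using arg_cong[OF uwv, of "\<lambda>v. v ! (length u + i)"] by simp
    then show ?thesis using that by (simp add: nth_append)
  qed
  then show "\<exists>k. \<forall>i<length w. a (k + i) = w ! i" by blast
qed

lemma extension_chain_through_all_words:
  fixes P :: "nat list \<Rightarrow> bool"
  assumes nil: "P []" and extend: "\<And>v w. P v \<Longrightarrow> set w \<subseteq> {..n} \<Longrightarrow> \<exists>u. P (v @ u @ w)"
  obtains V where "\<And>k. P (V k)" "\<And>k. prefix (V k) (V (Suc k))" "\<And>k. k \<le> length (V k)"
    "\<And>w. set w \<subseteq> {..n} \<Longrightarrow> \<exists>k u v. V k = u @ w @ v"
proof -
  define word where "word = from_nat_into (lists {..n})"
  have "countable (lists {..n})" "lists {..n} \<noteq> {}" by auto
  then have range_word: "range word = lists {..n}" unfolding word_def by (rule range_from_nat_into[rotated])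
  have "\<exists>v'. P v' \<and> (\<exists>u. v' = v @ u @ word k @ [0])" if "P v" for v k
    using extend[OF that, of "word k @ [0]"] rangeI[of word k] unfolding range_word by auto
  then obtain V where V: "\<And>k. P (V k)" "\<And>k. \<exists>u. V (Suc k) = V k @ u @ word k @ [0]"
    using dependent_nat_choice[of "\<lambda>_. P" "\<lambda>k v v'. \<exists>u. v' = v @ u @ word k @ [0]"] nil by blast
  show ?thesis
  proof (rule that)
    show "P (V k)" "prefix (V k) (V (Suc k))" for k using V by (blast, auto simp: prefix_def)
    show "k \<le> length (V k)" for k
    proof (induction k)
      case (Suc k)
      then show ?case using V(2)[of k] by auto
    qed simp
    fix w :: "nat list" assume "set w \<subseteq> {..n}"
    then have "w \<in> range word" unfolding range_word by auto
    then obtain k where "w = word k" by blast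
    then have "\<exists>u. V (Suc k) = (V k @ u) @ w @ [0]" using V(2)[of k] by auto
    then show "\<exists>k u v. V k = u @ w @ v" by blast
  qed
qed

lemma universal_sequence_from_extensions:
  assumes nil: "P []" and digits: "\<And>v. P v \<Longrightarrow> set v \<subseteq> {..n}"
    and extend: "\<And>v w. P v \<Longrightarrow> set w \<subseteq> {..n} \<Longrightarrow> \<exists>u. P (v @ u @ w)"
  obtains a where "\<And>k. a k \<le> n" "universal n a" "\<And>j. \<exists>v. P (map a [0..<j] @ v)"
proof -
  obtain V where V: "\<And>k. P (V k)" "\<And>k. prefix (V k) (V (Suc k))" "\<And>k. k \<le> length (V k)"
      "\<And>w. set w \<subseteq> {..n} \<Longrightarrow> \<exists>k u v. V k = u @ w @ v"
    using extension_chain_through_all_words[of P n] nil extend by metis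
  obtain a where a: "\<And>k. V k = map a [0..<length (V k)]" using prefix_chain_limit[OF V(2,3)] by metis
  have prefix: "\<exists>v. P (map a [0..<j] @ v)" for j
  proof -
    have "map a [0..<j] = take j (V j)" using V(3)[of j] by (subst a) (simp add: take_map)
    then show ?thesis using V(1)[of j] by (metis append_take_drop_id)
  qed
  have "a k \<le> n" for k
  proof -
    obtain v where "P (map a [0..<Suc k] @ v)" using prefix by blast
    then show ?thesis using digits by fastforce
  qed
  moreover have "universal n a" using V(4) a by (intro universalI) metis
  ultimately show ?thesis using prefix by (rule that)
qed

section \<open>Homogeneous iterated function systems near the identity\<close>

locale near_identity_ifs =
  fixes p :: "nat \<Rightarrow> 'a::euclidean_space" and n :: nat and lam :: real
  assumes full: "aff_dim (p ` {..n}) = int DIM('a)"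
    and lam: "0 < lam" "lam < 1"
    and near_identity: "real (n + 1) * ((1 / lam) ^ (n + 1) - 1) < 1/100"
begin

abbreviation hull_p :: "'a set" where
  "hull_p \<equiv> convex hull (p ` {..n})"

lemma power_near_1: "(1 / lam) ^ (n + 1) < 1 + 1/100"
proof -
  define Q where "Q = (1 / lam) ^ (n + 1)"
  have "1 \<le> Q" unfolding Q_def using lam by (intro one_le_power) auto
  then have "1 * (Q - 1) \<le> real (n + 1) * (Q - 1)" by (intro mult_right_mono) auto
  also have "\<dots> < 1/100" unfolding Q_def by (rule near_identity)
  finally show ?thesis unfolding Q_def by simp
qed

lemma attractor_eq: "attractor lam p n = hull_p"
proof (rule attractor_eq_convex_hull)
  define q where "q = 1 / lam"
  have "1 - lam = lam * (q - 1)" using lam by (simp add: q_def field_simps)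
  also have "\<dots> \<le> 1 * (q - 1)" using lam by (intro mult_right_mono) (auto simp: q_def)
  also have "\<dots> \<le> q ^ (n + 1) - 1" using lam self_le_power[of q "n + 1"] by (simp add: q_def)
  finally have "real (n + 1) * (1 - lam) \<le> real (n + 1) * ((1 / lam) ^ (n + 1) - 1)"
    unfolding q_def by (intro mult_left_mono) auto
  then show "real (n + 1) * (1 - lam) \<le> 1" using near_identity by linarith
qed (use lam in auto)

definition interior_prefix :: "'a \<Rightarrow> nat list \<Rightarrow> bool" where
  "interior_prefix x v \<longleftrightarrow> set v \<subseteq> {..n} \<and> x \<in> apply_word lam p v ` interior hull_p"

lemma apply_word_expand: "apply_word lam p (map d (rev [0..<m])) (expand (1 / lam) p d m x) = x"
proof (induction m arbitrary: x)
  case 0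
  show ?case by (simp add: expand_def)
next
  case (Suc m)
  define x' where "x' = (1 / lam) *\<^sub>R x - (1 / lam - 1) *\<^sub>R p (d m)"
  have "expand (1 / lam) p d (Suc m) x = expand (1 / lam) p d m x'"
    by (simp add: expand_def x'_def algebra_simps)
  moreover have "hmap lam p (d m) x' = x"
    using lam by (simp add: hmap_def x'_def scaleR_diff_right right_diff_distrib)
  ultimately show ?case using Suc[of x'] by simp
qed

lemma interior_prefix_extend:
  assumes v: "interior_prefix x v" and w: "set w \<subseteq> {..n}"
  shows "\<exists>u. interior_prefix x (v @ u @ w)"
proof -
  obtain z where z: "z \<in> interior hull_p" "x = apply_word lam p v z"
    using v by (auto simp: interior_prefix_def)
  obtain r where r: "0 < r" "ball z r \<subseteq> interior hull_p" using z(1) open_interior open_contains_ball by blast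
  have "1 < 1 / lam" "0 < lam ^ length w * r" using lam r(1) by auto
  moreover have "real (n + 1) * ((1 / lam) ^ (n + 1) - 1) \<le> 1/2" using near_identity by linarith
  ultimately obtain m d where d: "\<And>j. d j \<le> n"
      and near: "dist (expand (1 / lam) p d m z) (apply_word lam p w z) < lam ^ length w * r"
    using expand_dense[OF full _ power_near_1 _ z(1)] by metis
  define y where "y = expand (1 / lam) p d m z"
  define z' where "z' = z + (1 / lam ^ length w) *\<^sub>R (y - apply_word lam p w z)"
  have "dist z z' = dist y (apply_word lam p w z) / lam ^ length w"
    using lam by (simp add: z'_def dist_norm)
  also have "\<dots> < r" using near lam by (simp add: y_def divide_less_eq mult.commute)
  finally have z': "z' \<in> interior hull_p" using r(2) by auto
  have "apply_word lam p w z' - apply_word lam p w z = y - apply_word lam p w z"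
    unfolding apply_word_diff using lam by (simp add: z'_def)
  then have "x = apply_word lam p (v @ map d (rev [0..<m]) @ w) z'"
    using z(2) by (simp add: y_def apply_word_expand)
  then have "interior_prefix x (v @ map d (rev [0..<m]) @ w)"
    using z' v w d unfolding interior_prefix_def by auto
  then show ?thesis by blast
qed

lemma interior_point_has_universal_coding:
  assumes "x \<in> interior hull_p"
  obtains a where "\<And>k. a k \<le> n" "universal n a" "coding lam p a = x"
proof (rule universal_sequence_from_extensions)
  show "interior_prefix x []" using assms by (simp add: interior_prefix_def)
  show "set v \<subseteq> {..n}" if "interior_prefix x v" for v using that by (simp add: interior_prefix_def)
  show "\<exists>u. interior_prefix x (v @ u @ w)" if "interior_prefix x v" "set w \<subseteq> {..n}" for v w
    using that by (rule interior_prefix_extend)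
  fix a assume a: "\<And>k. a k \<le> n" "universal n a" "\<And>j. \<exists>v. interior_prefix x (map a [0..<j] @ v)"
  have "\<exists>z\<in>hull_p. x = word_map lam p a j z" for j
  proof -
    obtain v z where "set v \<subseteq> {..n}" "z \<in> interior hull_p" "x = apply_word lam p (map a [0..<j] @ v) z"
      using a(3)[of j] by (auto simp: interior_prefix_def)
    then show ?thesis
      using lam interior_subset by (intro bexI[of _ "apply_word lam p v z"])
        (auto simp: word_map_eq_apply_word intro!: apply_word_mem_convex_hull)
  qed
  then have "coding lam p a = x"
    using lam by (intro coding_eqI[of lam hull_p]) (auto simp: finite_imp_bounded_convex_hull)
  with a(1,2) show thesis by (rule that)
qed

theorem X_uni_eq_interior_attractor: "X_uni lam p n = interior (attractor lam p n)"
proof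
  show "X_uni lam p n \<subseteq> interior (attractor lam p n)"
    using universal_coding_in_interior[OF full lam] unfolding X_uni_def attractor_eq by blast
  show "interior (attractor lam p n) \<subseteq> X_uni lam p n"
    using interior_point_has_universal_coding interior_subset unfolding X_uni_def attractor_eq by blast
qed

end

theorem theorem1p2:
  fixes p :: "nat \<Rightarrow> 'a::euclidean_space" and n :: nat
  assumes "inj_on p {..n}"
    and "aff_dim (p ` {..n}) = int DIM('a)"
  shows "\<exists>\<delta>>0. \<forall>lam. 1 - \<delta> < lam \<and> lam < 1 \<longrightarrow>
           X_uni lam p n = interior (attractor lam p n)"
proof -
  have "((\<lambda>lam. real (n + 1) * ((1 / lam) ^ (n + 1) - 1))
      \<longlongrightarrow> real (n + 1) * ((1 / 1) ^ (n + 1) - 1)) (at_left 1)"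
    by (intro tendsto_intros) auto
  then have "\<forall>\<^sub>F lam in at_left 1. real (n + 1) * ((1 / lam) ^ (n + 1) - 1) < 1/100"
    by (rule order_tendstoD) simp
  moreover have "\<forall>\<^sub>F lam in at_left 1. lam \<in> {0<..<1::real}"
    by (intro eventually_at_left_real) simp
  ultimately have "\<forall>\<^sub>F lam in at_left 1. near_identity_ifs p n lam"
    by eventually_elim (use assms(2) in \<open>simp add: near_identity_ifs_def\<close>)
  then obtain b where "b < 1" and b: "\<And>lam. b < lam \<Longrightarrow> lam < 1 \<Longrightarrow> near_identity_ifs p n lam"
    unfolding eventually_at_left_field by blast
  show ?thesis
  proof (intro exI[of _ "1 - b"] conjI allI impI)
    show "0 < 1 - b" using \<open>b < 1\<close> by simp
    show "X_uni lam p n = interior (attractor lam p n)" if "1 - (1 - b) < lam \<and> lam < 1" for lam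
      using that by (intro near_identity_ifs.X_uni_eq_interior_attractor b) simp_all
  qed
qed

end
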